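(* Let $n,m\ge1$ and $w\ge0$, and let $(B_q)_{q\in\mathbb{N}}$ be a sequence of balls in $\mathbb{R}^m/\mathbb{Z}^m$. If the sets $\bigl(A_{n,m}(\mathbf{q},B_{|\mathbf{q}|})\bigr)_{\mathbf{q}\in\mathbb{Z}^n\setminus\{\mathbf0\}}$ are $w$-QIA, then for every integer $k\ge0$ the sets $\bigl(A_{n+k,m}(\mathbf{q},|\mathbf{q}|^{-k/m}B_{|\mathbf{q}|})\bigr)_{\mathbf{q}\in\mathbb{Z}^{n+k}\setminus\{\mathbf0\}}$ are $\max(w-k,0)$-QIA.
   Context: For $\mathbf{q}\in\mathbb{Z}^n$, $|\mathbf{q}|=\max_i|q_i|$. Balls are max-norm balls in $\mathbb{R}^m/\mathbb{Z}^m$; $cB$ is the ball with the same centre as $B$ and radius multiplied by $c>0$; $|\cdot|$ is Lebesgue measure. $A_{n,m}(\mathbf{q},B)=\{\mathbf{x}\in[0,1]^{nm}:\mathbf{q}\mathbf{x}+\mathbf{p}\in B\text{ for some }\mathbf{p}\in\mathbb{Z}^m\}$ ($\mathbf{x}$ an $n\times m$ matrix, $\mathbf{q}\mathbf{x}$ the row-vector–matrix product). For a sequence of balls $\Psi=(B_q)_{q\in\mathbb{N}}$ and $w\ge0$, the sets $(A_{n,m}(\mathbf{q},B_{|\mathbf{q}|}))_{\mathbf{q}\ne\mathbf0}$ are called $w$-weakly quasi-independent on average ($w$-QIA) if \[ \limsup_{Q\to\infty}\Bigl(\sum_{1\le|\mathbf{q}|\le Q}|B_{|\mathbf{q}|}|\Bigr)^2\Bigl(\sum_{1\le|\mathbf{q}_1|\le|\mathbf{q}_2|\le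 Q}\Bigl(\frac{\gcd(|\mathbf{q}_1|,|\mathbf{q}_2|)}{|\mathbf{q}_1|}\Bigr)^w\Bigl|A_{n,m}(\mathbf{q}_1,B_{|\mathbf{q}_1|})\cap A_{n,m}\Bigl(\mathbf{q}_2,\Bigl(\tfrac{|\mathbf{q}_1|}{|\mathbf{q}_2|}\Bigr)^{w/m}B_{|\mathbf{q}_2|}\Bigr)\Bigr|\Bigr)^{-1}>0, \] where both sums range over $\mathbf{q},\mathbf{q}_1,\mathbf{q}_2\in\mathbb{Z}^n$. ($0$-QIA coincides with usual quasi-independence on average, and $w$-QIA implies $w'$-QIA for $w\le w'$.) *)

theory Defs
  imports "HOL-Analysis.Analysis"
begin

text \<open>A max-norm ball in R^m/Z^m, represented by its centre (coordinates 0..m-1 used)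
  and its radius.\<close>
type_synonym tball = "(nat \<Rightarrow> real) \<times> real"

definition in_tball :: "nat \<Rightarrow> tball \<Rightarrow> (nat \<Rightarrow> real) \<Rightarrow> bool" where
  "in_tball m B y \<longleftrightarrow> (\<exists>p::nat \<Rightarrow> int. \<forall>j<m. \<bar>y j + of_int (p j) - fst B j\<bar> < snd B)"

text \<open>Lebesgue measure |B| of the ball in the torus R^m/Z^m (fundamental domain [0,1]^m).\<close>
definition tball_vol :: "nat \<Rightarrow> tball \<Rightarrow> real" where
  "tball_vol m B = measure (PiM {..<m} (\<lambda>_. lborel))
      {y \<in> PiE {..<m} (\<lambda>_. {0..1}). in_tball m B y}"

definition scale_ball :: "real \<Rightarrow> tball \<Rightarrow> tball" where
  "scale_ball c B = (fst B, c * snd B)"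

definition zvecs :: "nat \<Rightarrow> (nat \<Rightarrow> int) set" where
  "zvecs n = {q. \<forall>i\<ge>n. q i = 0}"

definition normv :: "nat \<Rightarrow> (nat \<Rightarrow> int) \<Rightarrow> nat" where
  "normv n q = nat (Max ((\<lambda>i. \<bar>q i\<bar>) ` {..<n}))"

definition Aset :: "nat \<Rightarrow> nat \<Rightarrow> (nat \<Rightarrow> int) \<Rightarrow> tball \<Rightarrow> (nat \<times> nat \<Rightarrow> real) set" where
  "Aset n m q B = {x \<in> PiE ({..<n} \<times> {..<m}) (\<lambda>_. {0..1}).
      in_tball m B (\<lambda>j. \<Sum>i<n. of_int (q i) * x (i, j))}"

definition matmeas :: "nat \<Rightarrow> nat \<Rightarrow> (nat \<times> nat \<Rightarrow> real) measure" where
  "matmeas n m = PiM ({..<n} \<times> {..<m}) (\<lambda>_. lborel)"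

definition QIA_num :: "nat \<Rightarrow> nat \<Rightarrow> (nat \<Rightarrow> tball) \<Rightarrow> nat \<Rightarrow> real" where
  "QIA_num n m B Q = (\<Sum>q\<in>{q\<in>zvecs n. 1 \<le> normv n q \<and> normv n q \<le> Q}.
       tball_vol m (B (normv n q)))"

definition QIA_den :: "nat \<Rightarrow> nat \<Rightarrow> real \<Rightarrow> (nat \<Rightarrow> tball) \<Rightarrow> nat \<Rightarrow> real" where
  "QIA_den n m w B Q = (\<Sum>(q1, q2)\<in>{(q1, q2). q1 \<in> zvecs n \<and> q2 \<in> zvecs n \<and>
        1 \<le> normv n q1 \<and> normv n q1 \<le> normv n q2 \<and> normv n q2 \<le> Q}.
     (real (gcd (normv n q1) (normv n q2)) / real (normv n q1)) powr w *
     measure (matmeas n m)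
       (Aset n m q1 (B (normv n q1)) \<inter>
        Aset n m q2 (scale_ball ((real (normv n q1) / real (normv n q2)) powr (w / real m))
                                (B (normv n q2)))))"

definition wQIA :: "nat \<Rightarrow> nat \<Rightarrow> real \<Rightarrow> (nat \<Rightarrow> tball) \<Rightarrow> bool" where
  "wQIA n m w B \<longleftrightarrow>
     0 < limsup (\<lambda>Q. ereal ((QIA_num n m B Q)\<^sup>2 / QIA_den n m w B Q))"

end

theory Submission
  imports Defs
begin

text \<open>For linearly independent q1 and q2 the two sets are independent, so such pairs contribute
  at most the square of the numerator. Parallel pairs of norms s and t are the multiples
  of a vector u of norm g = gcd s t by coprime integers, and their intersection has a measure that
  depends neither on u nor on the dimension. Passing from n to n + k multiplies the number of
  such u by about g^k, while shrinking both balls by the factor s^(-k/m) multiplies the measure of the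
  intersection by at most a constant times s^(-k). The result (g/s)^k is exactly what is
  gained by replacing the exponent w by w - k.\<close>

section \<open>Periodic integrals over the unit interval\<close>

text \<open>The radius of the second ball shows why the exponent drops by exactly \<open>k\<close>.
  In dimension \<open>n + k\<close> the ball of index \<open>t\<close> is shrunk by
  \<open>t^(-k/m)\<close> and then scaled by \<open>(s/t)^((w-k)/m)\<close>. The product is
  \<open>s^(-k/m) (s/t)^(w/m)\<close>: relative to the pair in dimension \<open>n\<close>, both
  balls shrink by one common factor that depends on \<open>s\<close> alone, and under a common
  factor the correlations of arcs can be compared. If \<open>w < k\<close>, the exponent
  \<open>w\<close> is first raised to \<open>k\<close>, which can only lower the denominator. The
  obstacle is saturation. A large ball may cover the torus both before and after shrinking, and then
  its correlations do not drop. But such a ball has volume 1, and adding \<open>k\<close>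
  coordinates does not decrease the total volume attached to a norm; this total is therefore at
  least 1, and the square of the numerator absorbs the loss. All estimates hold for each
  \<open>Q\<close> separately, so the limsup enters only at the very end.\<close>

definition unif :: "real measure" where
  "unif = density lborel (indicator {0..1})"

lemma sets_unif [simp, measurable_cong]: "sets unif = sets borel"
  by (simp add: unif_def)

lemma space_unif [simp]: "space unif = UNIV"
  by (simp add: unif_def)

lemma emeasure_unif: "A \<in> sets borel \<Longrightarrow> emeasure unif A = emeasure lborel (A \<inter> {0..1})"
  by (simp add: unif_def emeasure_restricted Int_commute)

lemma emeasure_unif_UNIV [simp]: "emeasure unif UNIV = 1"
  by (simp add: emeasure_unif)

lemma nn_integral_unif_closed:
  assumes "f \<in> borel_measurable borel"
  shows "(\<integral>\<^sup>+x. f x \<partial>unif) = (\<integral>\<^sup>+x. f x * indicator {0..1} x \<partial>lborel)"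
  unfolding unif_def using assms nn_integral_density[of "indicator {0..1}" lborel f]
  by (simp add: mult.commute)

text \<open>The half-open form is the one whose integer translates tile the line.\<close>

lemma nn_integral_unif:
  assumes "f \<in> borel_measurable borel"
  shows "(\<integral>\<^sup>+x. f x \<partial>unif) = (\<integral>\<^sup>+x. f x * indicator {0..<1} x \<partial>lborel)"
proof -
  have "(\<integral>\<^sup>+x. f x \<partial>unif) = (\<integral>\<^sup>+x. f x * indicator {0..1} x \<partial>lborel)"
    using assms by (intro nn_integral_unif_closed) simp
  also have "\<dots> = (\<integral>\<^sup>+x. f x * indicator {0..<1} x \<partial>lborel)"
    using AE_lborel_singleton[of 1]
    by (intro nn_integral_cong_AE) (rule eventually_mono, assumption, auto simp add: indicator_def)
  finally show ?thesis .
qed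

interpretation unif: finite_measure unif
  by standard simp

interpretation unifs: product_sigma_finite "\<lambda>_. unif"
  by standard

interpretation lborels: product_sigma_finite "\<lambda>_. lborel :: real measure"
  by standard

text \<open>The measure \<open>unif\<close> lives on all of the line, so shifts and integer
  multiples of its variable never leave the space. This identity leads back to the cube with
  \<open>lborel\<close> factors in the definitions.\<close>

lemma PiM_unif_eq_density:
  assumes "finite I"
  shows "PiM I (\<lambda>_. unif) = density (PiM I (\<lambda>_. lborel)) (indicator (PiE I (\<lambda>_. {0..1})))"
proof (rule unifs.PiM_eqI[OF assms, symmetric])
  show "sets (density (Pi\<^sub>M I (\<lambda>_. lborel)) (indicator (PiE I (\<lambda>_. {0..1::real})))) = sets (Pi\<^sub>M I (\<lambda>_. unif))"
    unfolding sets_density by (intro sets_PiM_cong) auto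
next
  fix A :: "'a \<Rightarrow> real set"
  assume A: "\<And>i. i \<in> I \<Longrightarrow> A i \<in> sets unif"
  have m: "PiE I (\<lambda>_. {0..1::real}) \<in> sets (PiM I (\<lambda>_. lborel))"
    using assms by (intro sets_PiM_I_finite) auto
  have "emeasure (density (Pi\<^sub>M I (\<lambda>_. lborel)) (indicator (PiE I (\<lambda>_. {0..1})))) (Pi\<^sub>E I A)
     = emeasure (Pi\<^sub>M I (\<lambda>_. lborel)) (Pi\<^sub>E I A \<inter> PiE I (\<lambda>_. {0..1}))"
    using A assms m
    by (subst emeasure_restricted) (auto simp: Int_commute intro!: sets_PiM_I_finite)
  also have "Pi\<^sub>E I A \<inter> PiE I (\<lambda>_. {0..1}) = PiE I (\<lambda>i. A i \<inter> {0..1})"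
    by (simp add: PiE_Int)
  also have "emeasure (Pi\<^sub>M I (\<lambda>_. lborel)) \<dots> = (\<Prod>i\<in>I. emeasure unif (A i))"
    using A assms by (subst lborels.emeasure_PiM) (auto simp: emeasure_unif intro!: prod.cong)
  finally show "emeasure (density (Pi\<^sub>M I (\<lambda>_. lborel)) (indicator (PiE I (\<lambda>_. {0..1})))) (Pi\<^sub>E I A)
    = (\<Prod>i\<in>I. emeasure unif (A i))" .
qed

lemma emeasure_PiM_unif:
  assumes "finite I" "S \<in> sets (PiM I (\<lambda>_. borel))"
  shows "emeasure (PiM I (\<lambda>_. lborel)) (S \<inter> PiE I (\<lambda>_. {0..1})) = emeasure (PiM I (\<lambda>_. unif)) S"
proof -
  have m: "PiE I (\<lambda>_. {0..1::real}) \<in> sets (PiM I (\<lambda>_. lborel))"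
    using assms by (intro sets_PiM_I_finite) auto
  have s: "S \<in> sets (PiM I (\<lambda>_. lborel))"
    using assms(2) sets_PiM_cong[OF refl, of I "\<lambda>_. borel :: real measure" "\<lambda>_. lborel"] by simp
  show ?thesis
    unfolding PiM_unif_eq_density[OF assms(1)] by (subst emeasure_restricted[OF m s]) (simp add: Int_commute)
qed

lemma nn_integral_shift_lborel:
  assumes [measurable]: "f \<in> borel_measurable borel"
  shows "(\<integral>\<^sup>+x. f (x + c) \<partial>lborel) = (\<integral>\<^sup>+x. f x \<partial>(lborel::real measure))"
  using nn_integral_real_affine[of f 1 c] assms by (simp add: add.commute)

lemma periodic_of_int:
  fixes f :: "real \<Rightarrow> 'a"
  assumes "\<And>x. f (x + 1) = f x"
  shows "f (x + of_int k) = f x"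
proof (induction k rule: int_induct[where k=0])
  case (step1 i)
  then show ?case using assms[of "x + of_int i"] by (simp add: add.assoc)
next
  case (step2 i)
  then show ?case using assms[of "x + of_int (i-1)"] by simp
qed simp

text \<open>Cut the window at the integer \<open>k + 1\<close>. The right part, moved back by one
  period, completes the left part to an interval from \<open>k\<close> to \<open>k + 1\<close>, and
  a shift by \<open>k\<close> ends at the unit interval.\<close>

lemma nn_integral_unit_interval_periodic:
  fixes f :: "real \<Rightarrow> ennreal"
  assumes [measurable]: "f \<in> borel_measurable borel" and p: "\<And>x. f (x + 1) = f x"
  shows "(\<integral>\<^sup>+x. f x * indicator {a..<a+1} x \<partial>lborel) = (\<integral>\<^sup>+x. f x \<partial>unif)"
proof -
  define k where "k = \<lfloor>a\<rfloor>"
  have k: "of_int k \<le> a" "a < of_int k + 1" unfolding k_def by linarith+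
  have "(\<integral>\<^sup>+x. f x * indicator {a..<a+1} x \<partial>lborel)
     = (\<integral>\<^sup>+x. f x * indicator {a..<of_int k+1} x + f x * indicator {of_int k + 1..<a+1} x \<partial>lborel)"
    using k by (intro nn_integral_cong) (auto simp: indicator_def)
  also have "\<dots> = (\<integral>\<^sup>+x. f x * indicator {a..<of_int k+1} x \<partial>lborel) + (\<integral>\<^sup>+x. f x * indicator {of_int k + 1..<a+1} x \<partial>lborel)"
    by (intro nn_integral_add) auto
  also have "(\<integral>\<^sup>+x. f x * indicator {of_int k + 1..<a+1} x \<partial>lborel)
     = (\<integral>\<^sup>+x. f (x + 1) * indicator {of_int k + 1..<a+1} (x + 1) \<partial>lborel)"
    by (rule nn_integral_shift_lborel[symmetric]) simp
  also have "\<dots> = (\<integral>\<^sup>+x. f x * indicator {of_int k..<a} x \<partial>lborel)"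
    by (intro nn_integral_cong) (auto simp: p indicator_def)
  also have "(\<integral>\<^sup>+x. f x * indicator {a..<of_int k+1} x \<partial>lborel) + \<dots> =
     (\<integral>\<^sup>+x. f x * indicator {a..<of_int k+1} x + f x * indicator {of_int k..<a} x \<partial>lborel)"
    by (intro nn_integral_add[symmetric]) auto
  also have "\<dots> = (\<integral>\<^sup>+x. f x * indicator {of_int k..<of_int k+1} x \<partial>lborel)"
    using k by (intro nn_integral_cong) (auto simp: indicator_def)
  also have "\<dots> = (\<integral>\<^sup>+x. f (x + of_int k) * indicator {of_int k..<of_int k+1} (x + of_int k) \<partial>lborel)"
    by (rule nn_integral_shift_lborel[symmetric]) simp
  also have "\<dots> = (\<integral>\<^sup>+x. f x * indicator {0..<1} x \<partial>lborel)"
    by (intro nn_integral_cong) (auto simp: periodic_of_int[of f, OF p] indicator_def)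
  finally show ?thesis by (simp add: nn_integral_unif)
qed

lemma nn_integral_interval_periodic:
  fixes f :: "real \<Rightarrow> ennreal"
  assumes [measurable]: "f \<in> borel_measurable borel" and p: "\<And>x. f (x + 1) = f x"
  shows "(\<integral>\<^sup>+x. f x * indicator {a..<a+real N} x \<partial>lborel) = of_nat N * (\<integral>\<^sup>+x. f x \<partial>unif)"
proof (induction N)
  case (Suc N)
  have "(\<integral>\<^sup>+x. f x * indicator {a..<a+real (Suc N)} x \<partial>lborel)
      = (\<integral>\<^sup>+x. f x * indicator {a..<a+real N} x + f x * indicator {a + real N..<(a + real N) +1} x \<partial>lborel)"
    by (intro nn_integral_cong) (auto simp: indicator_def)
  also have "\<dots> = (\<integral>\<^sup>+x. f x * indicator {a..<a+real N} x \<partial>lborel) + 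
      (\<integral>\<^sup>+x. f x * indicator {a + real N..<(a + real N) +1} x \<partial>lborel)"
    by (intro nn_integral_add) auto
  also have "\<dots> = of_nat (Suc N) * (\<integral>\<^sup>+x. f x \<partial>unif)"
    by (simp only: Suc nn_integral_unit_interval_periodic[OF assms, of "a + real N"] of_nat_Suc distrib_right mult_1_left add.commute[of 1])
  finally show ?case .
qed simp

lemma nn_integral_unif_reflect:
  fixes f :: "real \<Rightarrow> ennreal"
  assumes [measurable]: "f \<in> borel_measurable borel" 
  shows "(\<integral>\<^sup>+x. f (1 - x) \<partial>unif) = (\<integral>\<^sup>+x. f x \<partial>unif)"
proof -
  have "(\<integral>\<^sup>+x. f x \<partial>unif) = (\<integral>\<^sup>+x. f x * indicator {0..1} x \<partial>lborel)"
    using assms by (intro nn_integral_unif_closed) simp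
  also have "\<dots> = (\<integral>\<^sup>+x. f (1 - x) * indicator {0..1} (1 - x) \<partial>lborel)"
    by (subst nn_integral_real_affine[where c="-1" and t=1]) auto
  also have "\<dots> = (\<integral>\<^sup>+x. f (1 - x) * indicator {0..1} x \<partial>lborel)"
    by (intro nn_integral_cong) (auto simp: indicator_def)
  also have "\<dots> = (\<integral>\<^sup>+x. f (1 - x) \<partial>unif)"
    using assms by (intro nn_integral_unif_closed[symmetric]) simp
  finally show ?thesis ..
qed

text \<open>The substitution leads to an interval of length \<open>e\<close>, that is
  \<open>e\<close> periods, and its Jacobian \<open>e\<close> cancels their number. In terms of the
  circle: multiplication by \<open>e\<close> followed by a rotation preserves Lebesgue
  measure.\<close>

lemma nn_integral_unif_affine_pos:
  fixes f :: "real \<Rightarrow> ennreal"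
  assumes [measurable]: "f \<in> borel_measurable borel" and p: "\<And>x. f (x + 1) = f x" and e: "e > 0"
  shows "(\<integral>\<^sup>+x. f (real e * x + c) \<partial>unif) = (\<integral>\<^sup>+x. f x \<partial>unif)"
proof -
  have "of_nat e * (\<integral>\<^sup>+x. f x \<partial>unif) = (\<integral>\<^sup>+x. f x * indicator {c..<c+real e} x \<partial>lborel)"
    by (rule nn_integral_interval_periodic[OF assms(1,2), symmetric])
  also have "\<dots> = of_nat e * (\<integral>\<^sup>+x. f (c + real e * x) * indicator {c..<c+real e} (c + real e * x) \<partial>lborel)"
    using e by (subst nn_integral_real_affine[where c="real e" and t=c]) (auto simp: ennreal_of_nat_eq_real_of_nat)
  also have "(\<integral>\<^sup>+x. f (c + real e * x) * indicator {c..<c+real e} (c + real e * x) \<partial>lborel)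
     = (\<integral>\<^sup>+x. f (c + real e * x) * indicator {0..<1} x \<partial>lborel)"
    using e by (intro nn_integral_cong) (auto simp: indicator_def zero_le_mult_iff)
  also have "\<dots> = (\<integral>\<^sup>+x. f (real e * x + c) \<partial>unif)"
    by (simp add: nn_integral_unif add.commute)
  finally show ?thesis
    using e by (simp add: ennreal_mult_cancel_left)
qed

lemma nn_integral_unif_affine:
  fixes f :: "real \<Rightarrow> ennreal" and e :: int
  assumes [measurable]: "f \<in> borel_measurable borel" and p: "\<And>x. f (x + 1) = f x" and e: "e \<noteq> 0"
  shows "(\<integral>\<^sup>+x. f (of_int e * x + c) \<partial>unif) = (\<integral>\<^sup>+x. f x \<partial>unif)"
proof (cases "e > 0")
  case True
  then have "of_int e = real (nat e)" by simp
  then show ?thesis using nn_integral_unif_affine_pos[OF assms(1,2), of "nat e" c] True by simp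
next
  case False
  then have e': "of_int e = - real (nat (-e))" using e by simp
  \<comment> \<open>The reflection makes the slope positive; the constant that it produces is
    absorbed into the shift of the positive case.\<close>
  have "(\<integral>\<^sup>+x. f (of_int e * x + c) \<partial>unif) = (\<integral>\<^sup>+x. f (of_int e * (1 - x) + c) \<partial>unif)"
    by (rule nn_integral_unif_reflect[symmetric]) simp
  also have "\<dots> = (\<integral>\<^sup>+x. f (real (nat (-e)) * x + (c - real (nat (-e)))) \<partial>unif)"
    by (intro nn_integral_cong arg_cong[of _ _ f]) (simp add: e' algebra_simps)
  also have "\<dots> = (\<integral>\<^sup>+x. f x \<partial>unif)"
    using False e by (intro nn_integral_unif_affine_pos[of f "nat (-e)" "c - real (nat (-e))", OF assms(1,2)]) auto
  finally show ?thesis .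
qed

text \<open>The integrand is periodic in both variables. Replacing x by v2 x and then, for each x,
  y by y - v1 x removes x from the argument of g, after which the integral over x is that of f.\<close>

lemma nn_integral_unif_pair:
  fixes f g :: "real \<Rightarrow> ennreal" and u1 u2 v1 v2 :: int
  assumes [measurable]: "f \<in> borel_measurable borel" "g \<in> borel_measurable borel"
    and pf: "\<And>x. f (x + 1) = f x" and pg: "\<And>x. g (x + 1) = g x"
    and v2: "v2 \<noteq> 0" and D: "u1 * v2 \<noteq> u2 * v1"
  shows "(\<integral>\<^sup>+x. \<integral>\<^sup>+y. f (of_int u1 * x + of_int u2 * y + c) * g (of_int v1 * x + of_int v2 * y + d) \<partial>unif \<partial>unif)
    = (\<integral>\<^sup>+x. f x \<partial>unif) * (\<integral>\<^sup>+x. g x \<partial>unif)"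
proof -
  let ?H = "\<lambda>x y. f (of_int u1 * x + of_int u2 * y + c) * g (of_int v1 * x + of_int v2 * y + d)"
  define h where "h x = (\<integral>\<^sup>+y. ?H x y \<partial>unif)" for x
  note pf' = periodic_of_int[of f, OF pf] and pg' = periodic_of_int[of g, OF pg]
  have hm: "h \<in> borel_measurable borel" unfolding h_def 
    by measurable
  have "(\<integral>\<^sup>+x. h x \<partial>unif) = (\<integral>\<^sup>+x. h (of_int v2 * x + 0) \<partial>unif)"
  proof (rule nn_integral_unif_affine[symmetric, OF hm _ v2])
    fix x
    have "?H (x + 1) y = ?H x y" for y
      using pf'[of "of_int u1 * x + of_int u2 * y + c" u1] pg'[of "of_int v1 * x + of_int v2 * y + d" v1]
      by (simp add: algebra_simps)
    then show "h (x + 1) = h x" unfolding h_def by simp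
  qed
  also have "\<dots> = (\<integral>\<^sup>+x. \<integral>\<^sup>+y. f (of_int (u1 * v2 - u2 * v1) * x + (of_int u2 * y + c)) * g (of_int v2 * y + d) \<partial>unif \<partial>unif)"
  proof (intro nn_integral_cong)
    fix x :: real
    have "h (of_int v2 * x + 0) = (\<integral>\<^sup>+y. ?H (of_int v2 * x) (of_int 1 * y + (- of_int v1 * x)) \<partial>unif)"
      unfolding h_def add_0_right
    proof (rule nn_integral_unif_affine[symmetric])
      fix y
      show "?H (of_int v2 * x) (y + 1) = ?H (of_int v2 * x) y"
        using pf'[of "of_int u1 * (of_int v2 * x) + of_int u2 * y + c" u2] 
          pg'[of "of_int v1 * (of_int v2 * x) + of_int v2 * y + d" v2]
        by (simp add: algebra_simps)
    qed auto
    also have "\<dots> = (\<integral>\<^sup>+y. f (of_int (u1 * v2 - u2 * v1) * x + (of_int u2 * y + c)) * g (of_int v2 * y + d) \<partial>unif)"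
      by (intro nn_integral_cong arg_cong2[where f="(*)"] arg_cong[of _ _ f] arg_cong[of _ _ g])
         (auto simp: algebra_simps)
    finally show "h (of_int v2 * x + 0) = \<dots>" .
  qed
  also have "\<dots> = (\<integral>\<^sup>+y. \<integral>\<^sup>+x. f (of_int (u1 * v2 - u2 * v1) * x + (of_int u2 * y + c)) * g (of_int v2 * y + d) \<partial>unif \<partial>unif)"
    by (rule pair_sigma_finite.Fubini'[symmetric]) (unfold_locales, measurable)
  \<comment> \<open>The slope of the argument of \<open>f\<close> in \<open>x\<close> is now the
    determinant, nonzero by \<open>D\<close>.\<close>
  also have "\<dots> = (\<integral>\<^sup>+y. (\<integral>\<^sup>+x. f x \<partial>unif) * g (of_int v2 * y + d) \<partial>unif)"
  proof (intro nn_integral_cong)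
    fix y :: real
    show "(\<integral>\<^sup>+x. f (of_int (u1 * v2 - u2 * v1) * x + (of_int u2 * y + c)) * g (of_int v2 * y + d) \<partial>unif)
      = (\<integral>\<^sup>+x. f x \<partial>unif) * g (of_int v2 * y + d)"
      using D nn_integral_unif_affine[of f "u1 * v2 - u2 * v1" "of_int u2 * y + c", OF assms(1) pf]
      by (subst nn_integral_multc) (simp_all del: of_int_diff of_int_mult)
  qed
  also have "\<dots> = (\<integral>\<^sup>+x. f x \<partial>unif) * (\<integral>\<^sup>+x. g x \<partial>unif)"
    using nn_integral_unif_affine[of g v2 d, OF assms(2) pg v2] by (subst nn_integral_cmult) simp_all
  finally show ?thesis unfolding h_def .
qed

section \<open>Linear forms on the cube\<close>

abbreviation cube :: "'a set \<Rightarrow> ('a \<Rightarrow> real) measure" where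
  "cube I \<equiv> PiM I (\<lambda>_. unif)"

lemma emeasure_cube_space: "finite I \<Longrightarrow> emeasure (cube I) (space (cube I)) = 1"
  using unifs.emeasure_PiM[of I "\<lambda>_. UNIV"] by (simp add: space_PiM)

lemma finite_measure_cube: "finite I \<Longrightarrow> finite_measure (cube I)"
  by (rule finite_measureI) (simp add: emeasure_cube_space)

lemma borel_measurable_linear_form [measurable]:
  "(\<lambda>y. \<Sum>l\<in>I. of_int (u l) * y l) \<in> borel_measurable (cube I)"
  by (intro borel_measurable_sum borel_measurable_times) auto

text \<open>Integrate over coordinate \<open>i\<close> first: with the others fixed, the form is
  affine in it with nonzero integer slope, so the inner integral is already the constant on the
  right.\<close>

lemma nn_integral_cube_linear_form:
  fixes f :: "real \<Rightarrow> ennreal" and u :: "'a \<Rightarrow> int"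
  assumes fin: "finite I" and i: "i \<in> I" "u i \<noteq> 0"
    and [measurable]: "f \<in> borel_measurable borel" and p: "\<And>x. f (x + 1) = f x"
  shows "(\<integral>\<^sup>+y. f (\<Sum>l\<in>I. of_int (u l) * y l) \<partial>cube I) = (\<integral>\<^sup>+x. f x \<partial>unif)"
proof -
  define J where "J = I - {i}"
  have J: "finite J" "i \<notin> J" "insert i J = I" using fin i by (auto simp: J_def)
  have "(\<integral>\<^sup>+y. f (\<Sum>l\<in>I. of_int (u l) * y l) \<partial>cube I)
     = (\<integral>\<^sup>+z. \<integral>\<^sup>+x. f (\<Sum>l\<in>insert i J. of_int (u l) * (z(i := x)) l) \<partial>unif \<partial>cube J)"
    unfolding J(3)[symmetric] using J(1,2) by (intro unifs.product_nn_integral_insert) measurable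
  also have "\<dots> = (\<integral>\<^sup>+z. \<integral>\<^sup>+x. f (of_int (u i) * x + (\<Sum>l\<in>J. of_int (u l) * z l)) \<partial>unif \<partial>cube J)"
  proof -
    have "(\<Sum>l\<in>insert i J. of_int (u l) * (z(i := x)) l) = of_int (u i) * x + (\<Sum>l\<in>J. of_int (u l) * z l)"
      for z :: "'a \<Rightarrow> real" and x
      using J(1,2) by (subst sum.insert) (auto intro!: sum.cong)
    then show ?thesis by simp
  qed
  also have "\<dots> = (\<integral>\<^sup>+z. (\<integral>\<^sup>+x. f x \<partial>unif) \<partial>cube J)"
    by (intro nn_integral_cong nn_integral_unif_affine[of f "u i"] i(2) p assms(4))
  also have "\<dots> = (\<integral>\<^sup>+x. f x \<partial>unif)"
    by (simp add: emeasure_cube_space J)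
  finally show ?thesis .
qed

text \<open>Here the two coordinates of a nonvanishing minor of the pair \<open>u\<close>,
  \<open>v\<close> are integrated first; the remaining ones only contribute the shifts of
  \<open>nn_integral_unif_pair\<close>.\<close>

lemma nn_integral_cube_linear_form_pair:
  fixes f g :: "real \<Rightarrow> ennreal" and u v :: "'a \<Rightarrow> int"
  assumes fin: "finite I" and ij: "i \<in> I" "j \<in> I" "v j \<noteq> 0" "u i * v j \<noteq> u j * v i"
    and [measurable]: "f \<in> borel_measurable borel" "g \<in> borel_measurable borel"
    and pf: "\<And>x. f (x + 1) = f x" and pg: "\<And>x. g (x + 1) = g x"
  shows "(\<integral>\<^sup>+y. f (\<Sum>l\<in>I. of_int (u l) * y l) * g (\<Sum>l\<in>I. of_int (v l) * y l) \<partial>cube I)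
    = (\<integral>\<^sup>+x. f x \<partial>unif) * (\<integral>\<^sup>+x. g x \<partial>unif)"
proof -
  have neq: "i \<noteq> j" using ij by auto
  define K where "K = I - {i, j}"
  have K: "finite K" "i \<notin> insert j K" "j \<notin> K" "insert i (insert j K) = I"
    using fin ij neq by (auto simp: K_def)
  have Kf: "finite (insert j K)" using K by simp
  let ?F = "\<lambda>y. f (\<Sum>l\<in>insert i (insert j K). of_int (u l) * y l) * g (\<Sum>l\<in>insert i (insert j K). of_int (v l) * y l)"
  have "(\<integral>\<^sup>+y. ?F y \<partial>cube (insert i (insert j K)))
     = (\<integral>\<^sup>+z. \<integral>\<^sup>+x. ?F (z(i := x)) \<partial>unif \<partial>cube (insert j K))"
    using K by (intro unifs.product_nn_integral_insert) measurable
  also have "\<dots> = (\<integral>\<^sup>+z. \<integral>\<^sup>+y. \<integral>\<^sup>+x. ?F (z(j := y, i := x)) \<partial>unif \<partial>unif \<partial>cube K)"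
    using K by (intro unifs.product_nn_integral_insert) measurable
  also have "\<dots> = (\<integral>\<^sup>+z. (\<integral>\<^sup>+x. f x \<partial>unif) * (\<integral>\<^sup>+x. g x \<partial>unif) \<partial>cube K)"
  proof (intro nn_integral_cong)
    fix z :: "'a \<Rightarrow> real"
    have s: "(\<Sum>l\<in>insert i (insert j K). of_int (w l) * (z(j := y, i := x)) l)
        = of_int (w i) * x + of_int (w j) * y + (\<Sum>l\<in>K. of_int (w l) * z l)" for w :: "'a \<Rightarrow> int" and x y
      using K neq by (subst sum.insert, simp, simp, subst sum.insert) (auto intro!: sum.cong)
    let ?H = "\<lambda>x y. f (of_int (u i) * x + of_int (u j) * y + (\<Sum>l\<in>K. of_int (u l) * z l)) *
      g (of_int (v i) * x + of_int (v j) * y + (\<Sum>l\<in>K. of_int (v l) * z l))"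
    have "(\<integral>\<^sup>+y. \<integral>\<^sup>+x. ?H x y \<partial>unif \<partial>unif) = (\<integral>\<^sup>+x. \<integral>\<^sup>+y. ?H x y \<partial>unif \<partial>unif)"
      by (rule pair_sigma_finite.Fubini') (unfold_locales, measurable)
    also have "\<dots> = (\<integral>\<^sup>+x. f x \<partial>unif) * (\<integral>\<^sup>+x. g x \<partial>unif)"
      by (rule nn_integral_unif_pair) (use ij pf pg in auto)
    finally show "(\<integral>\<^sup>+y. \<integral>\<^sup>+x. ?F (z(j := y, i := x)) \<partial>unif \<partial>unif) = (\<integral>\<^sup>+x. f x \<partial>unif) * (\<integral>\<^sup>+x. g x \<partial>unif)"
      unfolding s .
  qed
  also have "\<dots> = (\<integral>\<^sup>+x. f x \<partial>unif) * (\<integral>\<^sup>+x. g x \<partial>unif)"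
    by (simp add: emeasure_cube_space K)
  finally show ?thesis unfolding K(4) .
qed

section \<open>Arcs of the circle, as 1-periodic open subsets of the line\<close>

definition circ_arc :: "real \<Rightarrow> real \<Rightarrow> real set" where
  "circ_arc c r = {x. \<exists>p::int. \<bar>x + of_int p - c\<bar> < r}"

lemma circ_arc_eq_UN: "circ_arc c r = (\<Union>p::int. ball (c - of_int p) r)"
  by (auto simp: circ_arc_def dist_real_def abs_minus_commute algebra_simps)

lemma circ_arc_borel [measurable, simp]: "circ_arc c r \<in> sets borel"
  unfolding circ_arc_eq_UN by (intro borel_open open_UN) auto

lemma circ_arc_plus_1 [simp]: "x + 1 \<in> circ_arc c r \<longleftrightarrow> x \<in> circ_arc c r"
proof
  assume "x + 1 \<in> circ_arc c r"
  then obtain p :: int where "\<bar>x + 1 + of_int p - c\<bar> < r" by (auto simp: circ_arc_def)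
  then have "\<bar>x + of_int (p + 1) - c\<bar> < r" by (simp add: algebra_simps)
  then show "x \<in> circ_arc c r" unfolding circ_arc_def by blast
next
  assume "x \<in> circ_arc c r"
  then obtain p :: int where "\<bar>x + of_int p - c\<bar> < r" by (auto simp: circ_arc_def)
  then have "\<bar>x + 1 + of_int (p - 1) - c\<bar> < r" by (simp add: algebra_simps)
  then show "x + 1 \<in> circ_arc c r" unfolding circ_arc_def by blast
qed

lemma circ_arc_mono: "r \<le> r' \<Longrightarrow> circ_arc c r \<subseteq> circ_arc c r'"
  unfolding circ_arc_def using order.strict_trans2 by blast

text \<open>The integer shifts can be chosen for each coordinate separately, so a max-norm ball on
  the torus is a product of arcs.\<close>

lemma in_tball_iff: "in_tball m B y \<longleftrightarrow> (\<forall>j<m. y j \<in> circ_arc (fst B j) (snd B))"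
  unfolding in_tball_def circ_arc_def mem_Collect_eq by (rule choice_iff'[symmetric])

section \<open>Splitting matrices into columns\<close>

lemma measurable_uncurry:
  "(\<lambda>y. \<lambda>p\<in>I \<times> J. y (snd p) (fst p)) \<in> PiM J (\<lambda>_. cube I) \<rightarrow>\<^sub>M cube (I \<times> J)"
proof (rule measurable_restrict)
  fix p assume "p \<in> I \<times> J"
  then have "snd p \<in> J" "fst p \<in> I" by auto
  then show "(\<lambda>y. y (snd p) (fst p)) \<in> PiM J (\<lambda>_. cube I) \<rightarrow>\<^sub>M unif"
    by (intro measurable_compose[of "\<lambda>y. y (snd p)" _ "cube I" "\<lambda>z. z (fst p)"]
        measurable_component_singleton)
qed

text \<open>The columns of a uniformly distributed matrix are independent and uniformly
  distributed.\<close>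

lemma cube_curry:
  fixes I :: "'a set" and J :: "'b set"
  assumes I: "finite I" and J: "finite J"
  shows "distr (PiM J (\<lambda>_. cube I)) (cube (I \<times> J)) (\<lambda>y. \<lambda>p\<in>I \<times> J. y (snd p) (fst p)) = cube (I \<times> J)"
proof (rule unifs.PiM_eqI)
  interpret C: product_sigma_finite "\<lambda>_::'b. cube I"
    unfolding product_sigma_finite_def by (intro allI unifs.sigma_finite I)
  have [measurable]: "(\<lambda>y. \<lambda>p\<in>I \<times> J. y (snd p) (fst p)) \<in> PiM J (\<lambda>_. cube I) \<rightarrow>\<^sub>M cube (I \<times> J)"
    by (rule measurable_uncurry)
  fix A :: "'a \<times> 'b \<Rightarrow> real set"
  assume A: "\<And>i. i \<in> I \<times> J \<Longrightarrow> A i \<in> sets unif"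
  have "emeasure (distr (PiM J (\<lambda>_. cube I)) (cube (I \<times> J)) (\<lambda>y. \<lambda>p\<in>I \<times> J. y (snd p) (fst p))) (PiE (I \<times> J) A)
    = emeasure (PiM J (\<lambda>_. cube I)) (PiE J (\<lambda>j. PiE I (\<lambda>i. A (i, j))))"
  proof (subst emeasure_distr)
    show "Pi\<^sub>E (I \<times> J) A \<in> sets (cube (I \<times> J))"
      using A I J by (intro sets_PiM_I_finite) auto
    show "emeasure (Pi\<^sub>M J (\<lambda>_. cube I)) ((\<lambda>y. \<lambda>p\<in>I \<times> J. y (snd p) (fst p)) -` Pi\<^sub>E (I \<times> J) A \<inter> space (Pi\<^sub>M J (\<lambda>_. cube I)))
      = emeasure (Pi\<^sub>M J (\<lambda>_. cube I)) (\<Pi>\<^sub>E j\<in>J. \<Pi>\<^sub>E i\<in>I. A (i, j))"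
      by (intro arg_cong2[where f=emeasure]) (auto simp: space_PiM PiE_iff)
  qed simp
  also have "\<dots> = (\<Prod>j\<in>J. \<Prod>i\<in>I. emeasure unif (A (i, j)))"
    using A I J by (subst C.emeasure_PiM) (auto intro!: sets_PiM_I_finite prod.cong unifs.emeasure_PiM)
  also have "\<dots> = (\<Prod>i\<in>I \<times> J. emeasure unif (A i))"
    by (subst prod.swap) (simp add: prod.cartesian_product)
  finally show "emeasure (distr (PiM J (\<lambda>_. cube I)) (cube (I \<times> J)) (\<lambda>y. \<lambda>p\<in>I \<times> J. y (snd p) (fst p))) (PiE (I \<times> J) A)
    = (\<Prod>i\<in>I \<times> J. emeasure unif (A i))" .
qed (use I J in auto)

text \<open>This is the condition that membership in both sets imposes on a single column of the
  matrix.\<close>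

definition strip :: "nat \<Rightarrow> (nat \<Rightarrow> int) \<Rightarrow> (nat \<Rightarrow> int) \<Rightarrow> real set \<Rightarrow> real set \<Rightarrow> (nat \<Rightarrow> real) set" where
  "strip n q1 q2 S T = {y \<in> space (cube {..<n}).
     (\<Sum>i<n. of_int (q1 i) * y i) \<in> S \<and> (\<Sum>i<n. of_int (q2 i) * y i) \<in> T}"

lemma strip_sets [measurable]: "S \<in> sets borel \<Longrightarrow> T \<in> sets borel \<Longrightarrow> strip n q1 q2 S T \<in> sets (cube {..<n})"
  unfolding strip_def
  by (intro sets.sets_Collect_conj; rule measurable_sets_Collect[OF borel_measurable_linear_form]) auto

text \<open>Coordinate \<open>j\<close> of the product of a row vector and a matrix involves column
  \<open>j\<close> only, and balls are products of arcs. The intersection is thus a product over the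
  independent columns.\<close>

lemma measure_Aset_inter:
  "measure (matmeas n m) (Aset n m q1 B1 \<inter> Aset n m q2 B2)
   = (\<Prod>j<m. measure (cube {..<n}) (strip n q1 q2 (circ_arc (fst B1 j) (snd B1)) (circ_arc (fst B2 j) (snd B2))))"
proof -
  interpret C: product_sigma_finite "\<lambda>_::nat. cube ({..<n}::nat set)"
    unfolding product_sigma_finite_def by (intro allI unifs.sigma_finite) simp
  let ?I = "{..<n} \<times> {..<m}"
  let ?S = "\<lambda>j. strip n q1 q2 (circ_arc (fst B1 j) (snd B1)) (circ_arc (fst B2 j) (snd B2))"
  let ?f = "\<lambda>y. \<lambda>p\<in>?I. y (snd p) (fst p) :: real"
  \<comment> \<open>\<open>X\<close> does not ask the entries to lie in the unit interval; the
    measure \<open>unif\<close> takes care of that.\<close>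
  define X where "X = {x \<in> space (cube ?I). \<forall>j\<in>{..<m}.
     (\<Sum>i<n. of_int (q1 i) * x (i, j)) \<in> circ_arc (fst B1 j) (snd B1) \<and>
     (\<Sum>i<n. of_int (q2 i) * x (i, j)) \<in> circ_arc (fst B2 j) (snd B2)}"
  have comp: "(\<lambda>x. x (i, j)) \<in> borel_measurable (cube ?I)" if "i < n" "j < m" for i j
    using measurable_component_singleton[of "(i, j)" ?I "\<lambda>_. unif"] that by simp
  have lin: "(\<lambda>x. \<Sum>i<n. of_int (q i) * x (i, j)) \<in> borel_measurable (cube ?I)" if "j < m" for q :: "nat \<Rightarrow> int" and j
    using comp that by (intro borel_measurable_sum borel_measurable_times) auto
  have X: "X \<in> sets (cube ?I)"
    unfolding X_def
    by (intro sets.sets_Collect_finite_All sets.sets_Collect_conj; (rule measurable_sets_Collect[OF lin])?) auto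
  have XA: "X \<inter> PiE ?I (\<lambda>_. {0..1}) = Aset n m q1 B1 \<inter> Aset n m q2 B2"
    unfolding Aset_def X_def in_tball_iff by (auto simp: space_PiM PiE_iff extensional_def)
  have m: "?f \<in> PiM {..<m} (\<lambda>_. cube {..<n}) \<rightarrow>\<^sub>M cube ?I"
    by (rule measurable_uncurry)
  have "emeasure (matmeas n m) (Aset n m q1 B1 \<inter> Aset n m q2 B2) = emeasure (cube ?I) X"
    unfolding matmeas_def XA[symmetric] using X sets_PiM_cong[OF refl, of ?I "\<lambda>_. unif" "\<lambda>_. borel"]
    by (intro emeasure_PiM_unif) auto
  also have "\<dots> = emeasure (distr (PiM {..<m} (\<lambda>_. cube {..<n})) (cube ?I) ?f) X"
    by (subst cube_curry) auto
  also have "\<dots> = emeasure (PiM {..<m} (\<lambda>_. cube {..<n})) (PiE {..<m} ?S)"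
    unfolding emeasure_distr[OF m X]
    by (intro arg_cong2[where f=emeasure])
       (auto simp: X_def strip_def space_PiM PiE_iff extensional_def)
  also have "\<dots> = (\<Prod>j<m. emeasure (cube {..<n}) (?S j))"
    by (intro C.emeasure_PiM strip_sets) auto
  also have "\<dots> = (\<Prod>j<m. ennreal (measure (cube {..<n}) (?S j)))"
    by (intro prod.cong refl finite_measure.emeasure_eq_measure finite_measure_cube) simp
  also have "\<dots> = ennreal (\<Prod>j<m. measure (cube {..<n}) (?S j))"
    by (intro prod_ennreal) simp
  finally show ?thesis
    by (intro measure_eq_emeasure_eq_ennreal prod_nonneg) auto
qed

lemma tball_vol_eq: "tball_vol m B = (\<Prod>j<m. measure unif (circ_arc (fst B j) (snd B)))"
proof -
  have *: "{y \<in> PiE {..<m} (\<lambda>_. {0..1}). in_tball m B y}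
     = PiE {..<m} (\<lambda>j. circ_arc (fst B j) (snd B)) \<inter> PiE {..<m} (\<lambda>_. {0..1})"
    unfolding in_tball_iff by (rule set_eqI, simp only: mem_Collect_eq Int_iff PiE_iff lessThan_iff Ball_def, blast)
  have s: "PiE {..<m} (\<lambda>j. circ_arc (fst B j) (snd B)) \<in> sets (PiM {..<m} (\<lambda>_. borel))"
    by (intro sets_PiM_I_finite) auto
  have "emeasure (PiM {..<m} (\<lambda>_. lborel)) {y \<in> PiE {..<m} (\<lambda>_. {0..1}). in_tball m B y}
     = (\<Prod>j<m. emeasure unif (circ_arc (fst B j) (snd B)))"
    unfolding * emeasure_PiM_unif[OF finite_lessThan s] by (intro unifs.emeasure_PiM) auto
  also have "\<dots> = (\<Prod>j<m. ennreal (measure unif (circ_arc (fst B j) (snd B))))"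
    by (intro prod.cong refl unif.emeasure_eq_measure)
  also have "\<dots> = ennreal (\<Prod>j<m. measure unif (circ_arc (fst B j) (snd B)))"
    by (intro prod_ennreal) simp
  finally show ?thesis
    unfolding tball_vol_def by (intro measure_eq_emeasure_eq_ennreal prod_nonneg) auto
qed

text \<open>The one-variable remainder of the parallel forms \<open>a * u\<close> and
  \<open>b * u\<close>, in which neither \<open>u\<close> nor the dimension appears.\<close>

definition corr :: "int \<Rightarrow> int \<Rightarrow> real set \<Rightarrow> real set \<Rightarrow> real" where
  "corr a b S T = measure unif {x. of_int a * x \<in> S \<and> of_int b * x \<in> T}"

lemma emeasure_strip:
  assumes [measurable]: "S \<in> sets borel" "T \<in> sets borel"
  shows "emeasure (cube {..<n}) (strip n q1 q2 S T) = 
    (\<integral>\<^sup>+y. indicator S (\<Sum>i<n. of_int (q1 i) * y i) * indicator T (\<Sum>i<n. of_int (q2 i) * y i) \<partial>cube {..<n})"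
proof -
  have "emeasure (cube {..<n}) (strip n q1 q2 S T) = (\<integral>\<^sup>+y. indicator (strip n q1 q2 S T) y \<partial>cube {..<n})"
    by (rule nn_integral_indicator[symmetric]) simp
  also have "\<dots> = (\<integral>\<^sup>+y. indicator S (\<Sum>i<n. of_int (q1 i) * y i) * indicator T (\<Sum>i<n. of_int (q2 i) * y i) \<partial>cube {..<n})"
    by (intro nn_integral_cong) (auto simp: strip_def indicator_def)
  finally show ?thesis .
qed

lemma measure_strip_independent:
  assumes ij: "i < n" "j < n" "q2 j \<noteq> 0" "q1 i * q2 j \<noteq> q1 j * q2 i"
  shows "measure (cube {..<n}) (strip n q1 q2 (circ_arc c1 r1) (circ_arc c2 r2)) = measure unif (circ_arc c1 r1) * measure unif (circ_arc c2 r2)"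
proof -
  have "emeasure (cube {..<n}) (strip n q1 q2 (circ_arc c1 r1) (circ_arc c2 r2)) = emeasure unif (circ_arc c1 r1) * emeasure unif (circ_arc c2 r2)"
    unfolding emeasure_strip[OF circ_arc_borel circ_arc_borel]
    using nn_integral_cube_linear_form_pair[of "{..<n}" i j q2 q1 "indicator (circ_arc c1 r1)" "indicator (circ_arc c2 r2)"] ij
    by (simp add: indicator_def[of "circ_arc _ _" "_ + 1"])
  then show ?thesis by (simp add: measure_def enn2real_mult)
qed

text \<open>Both conditions depend only on the value of the form \<open>u\<close> modulo 1, which is
  uniformly distributed.\<close>

lemma measure_strip_parallel:
  assumes u: "i < n" "u i \<noteq> 0"
  shows "measure (cube {..<n}) (strip n (\<lambda>l. a * u l) (\<lambda>l. b * u l) (circ_arc c1 r1) (circ_arc c2 r2)) = corr a b (circ_arc c1 r1) (circ_arc c2 r2)"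
proof -
  let ?f = "\<lambda>x. indicator (circ_arc c1 r1) (of_int a * x) * indicator (circ_arc c2 r2) (of_int b * x) :: ennreal"
  have per: "of_int a * (x + 1) \<in> circ_arc c r \<longleftrightarrow> of_int a * x \<in> circ_arc c r" for a :: int and x c r
    using periodic_of_int[of "\<lambda>x. x \<in> circ_arc c r" "of_int a * x" a] by (simp add: algebra_simps)
  have "emeasure (cube {..<n}) (strip n (\<lambda>l. a * u l) (\<lambda>l. b * u l) (circ_arc c1 r1) (circ_arc c2 r2))
     = (\<integral>\<^sup>+y. ?f (\<Sum>i<n. of_int (u i) * y i) \<partial>cube {..<n})"
    unfolding emeasure_strip[OF circ_arc_borel circ_arc_borel] by (simp add: sum_distrib_left mult.assoc)
  also have "\<dots> = (\<integral>\<^sup>+x. ?f x \<partial>unif)"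
    using u by (intro nn_integral_cube_linear_form[of "{..<n}" i u ?f]) (auto simp: indicator_def per)
  also have "\<dots> = (\<integral>\<^sup>+x. indicator {x. of_int a * x \<in> circ_arc c1 r1 \<and> of_int b * x \<in> circ_arc c2 r2} x \<partial>unif)"
    by (intro nn_integral_cong) (auto simp: indicator_def)
  also have "\<dots> = emeasure unif {x. of_int a * x \<in> circ_arc c1 r1 \<and> of_int b * x \<in> circ_arc c2 r2}"
    by (intro nn_integral_indicator) measurable
  finally show ?thesis by (simp add: measure_def corr_def)
qed

section \<open>Arcs and their correlations\<close>

lemma measure_circ_arc:
  assumes "r \<ge> 0"
  shows "measure unif (circ_arc c r) = min 1 (2 * r)"
proof (cases "r \<le> 1 / 2")
  case True
  \<comment> \<open>In the window of length 1 centred at \<open>c\<close>, only the shift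
    \<open>p = 0\<close> is possible when \<open>r <= 1/2\<close>.\<close>
  have eq: "x \<in> circ_arc c r \<and> c - 1/2 \<le> x \<and> x < c - 1/2 + 1 \<longleftrightarrow> c - r < x \<and> x < c + r" for x
  proof
    assume *: "x \<in> circ_arc c r \<and> c - 1/2 \<le> x \<and> x < c - 1/2 + 1"
    then obtain p :: int where p: "\<bar>x + of_int p - c\<bar> < r" by (auto simp: circ_arc_def)
    then have "\<bar>of_int p :: real\<bar> < 1" using * True by linarith
    then have "p = 0" by linarith
    then show "c - r < x \<and> x < c + r" using p by auto
  next
    assume *: "c - r < x \<and> x < c + r"
    then have "\<bar>x + of_int 0 - c\<bar> < r" by auto
    then have "x \<in> circ_arc c r" unfolding circ_arc_def by blast
    then show "x \<in> circ_arc c r \<and> c - 1/2 \<le> x \<and> x < c - 1/2 + 1" using * True by auto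
  qed
  have "emeasure unif (circ_arc c r) = (\<integral>\<^sup>+x. indicator (circ_arc c r) x \<partial>unif)"
    by (rule nn_integral_indicator[symmetric]) simp
  also have "\<dots> = (\<integral>\<^sup>+x. indicator (circ_arc c r) x * indicator {c-1/2..<c-1/2+1} x \<partial>lborel)"
    by (rule nn_integral_unit_interval_periodic[symmetric]) (auto simp: indicator_def)
  also have "\<dots> = (\<integral>\<^sup>+x. indicator {c-r<..<c+r} x \<partial>lborel)"
  proof (intro nn_integral_cong)
    fix x
    show "indicator (circ_arc c r) x * indicator {c-1/2..<c-1/2+1} x = (indicator {c-r<..<c+r} x :: ennreal)"
      using eq[of x] unfolding indicator_def by auto
  qed
  also have "\<dots> = ennreal (2 * r)"
    using assms by simp
  finally show ?thesis
    using assms True by (simp add: measure_def min_def)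
next
  case False
  have "x \<in> circ_arc c r" for x
  proof -
    \<comment> \<open>Every point is within 1/2 of some integer translate of \<open>c\<close>, so
      the arc is everything.\<close>
    have "\<bar>x + of_int (- round (x - c)) - c\<bar> < r"
      using of_int_round_abs_le[of "x - c"] False
      unfolding of_int_minus by linarith
    then show ?thesis unfolding circ_arc_def by blast
  qed
  then have "circ_arc c r = UNIV" by auto
  then show ?thesis using False by (simp add: measure_def)
qed

lemma measure_unif_affine_preimage:
  fixes a :: int
  assumes "a \<noteq> 0"
  shows "measure unif {x. of_int a * x \<in> circ_arc c r} = measure unif (circ_arc c r)"
proof -
  have "emeasure unif {x. of_int a * x \<in> circ_arc c r} = (\<integral>\<^sup>+x. indicator {x. of_int a * x \<in> circ_arc c r} x \<partial>unif)"
    by (intro nn_integral_indicator[symmetric]) measurable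
  also have "\<dots> = (\<integral>\<^sup>+x. indicator (circ_arc c r) (of_int a * x + 0) \<partial>unif)"
    by (intro nn_integral_cong) (auto simp: indicator_def)
  also have "\<dots> = (\<integral>\<^sup>+x. indicator (circ_arc c r) x \<partial>unif)"
    using assms by (intro nn_integral_unif_affine[of "indicator (circ_arc c r)" a 0]) (auto simp: indicator_def)
  also have "\<dots> = emeasure unif (circ_arc c r)"
    by (rule nn_integral_indicator) simp
  finally show ?thesis by (simp add: measure_def)
qed

lemma corr_le_left:
  assumes "a \<noteq> 0"
  shows "corr a b (circ_arc c1 r1) (circ_arc c2 r2) \<le> measure unif (circ_arc c1 r1)"
  unfolding corr_def measure_unif_affine_preimage[OF assms, symmetric]
  by (intro unif.finite_measure_mono) (auto, measurable)

lemma corr_le_right: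
  assumes "b \<noteq> 0"
  shows "corr a b (circ_arc c1 r1) (circ_arc c2 r2) \<le> measure unif (circ_arc c2 r2)"
  unfolding corr_def measure_unif_affine_preimage[OF assms, symmetric]
  by (intro unif.finite_measure_mono) (auto, measurable)

lemma emeasure_lborel_Ioo': "emeasure lborel {l<..<u::real} = ennreal (u - l)"
  by (cases "l \<le> u") (auto simp: ennreal_neg)

text \<open>Scaling centres and half-lengths together would multiply the overlap by exactly
  \<open>t\<close>. Leaving the centres where they are keeps the intervals further apart, and the
  overlap can only be smaller.\<close>

lemma emeasure_Ioo_inter_scale:
  fixes m1 m2 d1 d2 t :: real
  assumes t: "0 \<le> t" "t \<le> 1"
  shows "emeasure lborel ({m1 - t * d1<..<m1 + t * d1} \<inter> {m2 - t * d2<..<m2 + t * d2})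
    \<le> ennreal t * emeasure lborel ({m1 - d1<..<m1 + d1} \<inter> {m2 - d2<..<m2 + d2})"
proof -
  have h1: "t * m2 - t * m1 \<le> m2 - m1" if "m1 \<le> m2"
    using mult_right_mono[of t 1 "m2 - m1"] that t by (simp add: algebra_simps)
  have h2: "t * m1 - t * m2 \<le> m1 - m2" if "m2 \<le> m1"
    using mult_right_mono[of t 1 "m1 - m2"] that t by (simp add: algebra_simps)
  have "min (m1 + t * d1) (m2 + t * d2) - max (m1 - t * d1) (m2 - t * d2)
     \<le> t * (min (m1 + d1) (m2 + d2) - max (m1 - d1) (m2 - d2))"
  \<comment> \<open>The cases record which end points bound the unscaled intersection. The same
    choice of end points in the scaled intersection yields an upper bound for it.\<close>
  proof (cases "m1 + d1 \<le> m2 + d2"; cases "m2 - d2 \<le> m1 - d1")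
    assume *: "m1 + d1 \<le> m2 + d2" "m2 - d2 \<le> m1 - d1"
    have "min (m1 + t * d1) (m2 + t * d2) - max (m1 - t * d1) (m2 - t * d2) \<le> 2 * (t * d1)" by linarith
    also have "\<dots> = t * (min (m1 + d1) (m2 + d2) - max (m1 - d1) (m2 - d2))" using * by (simp add: algebra_simps)
    finally show ?thesis .
  next
    assume *: "m1 + d1 \<le> m2 + d2" "\<not> m2 - d2 \<le> m1 - d1"
    have "min (m1 + t * d1) (m2 + t * d2) - max (m1 - t * d1) (m2 - t * d2) \<le> m1 - m2 + t * d1 + t * d2" by linarith
    also have "\<dots> \<le> t * (m1 - m2) + t * d1 + t * d2" using h1 * by (simp add: algebra_simps)
    also have "\<dots> = t * (min (m1 + d1) (m2 + d2) - max (m1 - d1) (m2 - d2))" using * by (simp add: algebra_simps)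
    finally show ?thesis .
  next
    assume *: "\<not> m1 + d1 \<le> m2 + d2" "m2 - d2 \<le> m1 - d1"
    have "min (m1 + t * d1) (m2 + t * d2) - max (m1 - t * d1) (m2 - t * d2) \<le> m2 - m1 + t * d1 + t * d2" by linarith
    also have "\<dots> \<le> t * (m2 - m1) + t * d1 + t * d2" using h2 * by (simp add: algebra_simps)
    also have "\<dots> = t * (min (m1 + d1) (m2 + d2) - max (m1 - d1) (m2 - d2))" using * by (simp add: algebra_simps)
    finally show ?thesis .
  next
    assume *: "\<not> m1 + d1 \<le> m2 + d2" "\<not> m2 - d2 \<le> m1 - d1"
    have "min (m1 + t * d1) (m2 + t * d2) - max (m1 - t * d1) (m2 - t * d2) \<le> 2 * (t * d2)" by linarith
    also have "\<dots> = t * (min (m1 + d1) (m2 + d2) - max (m1 - d1) (m2 - d2))" using * by (simp add: algebra_simps)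
    finally show ?thesis .
  qed
  then show ?thesis
    using t by (simp add: emeasure_lborel_Ioo' ennreal_leI flip: ennreal_mult')
qed

lemma abs_affine_less_iff:
  fixes a :: real
  assumes "a \<noteq> 0"
  shows "\<bar>a * x + p - c\<bar> < r \<longleftrightarrow> (c - p) / a - r / \<bar>a\<bar> < x \<and> x < (c - p) / a + r / \<bar>a\<bar>"
proof -
  have "\<bar>a * x + p - c\<bar> = \<bar>a\<bar> * \<bar>x - (c - p) / a\<bar>"
    using assms by (simp add: abs_mult[symmetric] field_simps)
  then have "\<bar>a * x + p - c\<bar> < r \<longleftrightarrow> \<bar>x - (c - p) / a\<bar> < r / \<bar>a\<bar>"
    using assms by (simp add: pos_less_divide_eq mult.commute)
  then show ?thesis by (auto simp: abs_less_iff)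
qed

text \<open>On the line, the set measured by the correlation is a disjoint union of intersections of
  two intervals, and each such intersection shrinks at least by the factor t. Restricting to
  the unit interval cuts some of them, which costs the factor 3.\<close>

lemma corr_scale:
  fixes a b :: int
  assumes a: "a \<noteq> 0" and b: "b \<noteq> 0" and t: "0 \<le> t" "t \<le> 1"
    and r: "0 \<le> r1" "r1 \<le> 1/2" "0 \<le> r2" "r2 \<le> 1/2"
  shows "corr a b (circ_arc c1 (t * r1)) (circ_arc c2 (t * r2)) \<le> 3 * t * corr a b (circ_arc c1 r1) (circ_arc c2 r2)"
proof -
  define E where "E s1 s2 = {x::real. of_int a * x \<in> circ_arc c1 s1 \<and> of_int b * x \<in> circ_arc c2 s2}" for s1 s2
  define I where "I s1 s2 = (\<lambda>(p, p'). {x::real. \<bar>of_int a * x + of_int p - c1\<bar> < s1 \<and> \<bar>of_int b * x + of_int p' - c2\<bar> < s2})"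
    for s1 s2
  have E_sets [measurable]: "E s1 s2 \<in> sets borel" for s1 s2
    unfolding E_def by measurable
  have I_sets: "I s1 s2 pp \<in> sets lborel" for s1 s2 pp
    unfolding I_def by (cases pp) simp
  have I_eq: "I s1 s2 (p, p') = {(c1 - of_int p) / of_int a - s1 / \<bar>of_int a\<bar><..<(c1 - of_int p) / of_int a + s1 / \<bar>of_int a\<bar>}
     \<inter> {(c2 - of_int p') / of_int b - s2 / \<bar>of_int b\<bar><..<(c2 - of_int p') / of_int b + s2 / \<bar>of_int b\<bar>}" for s1 s2 p p'
    using a b unfolding I_def by (auto simp: abs_affine_less_iff)
  have I_scale: "emeasure lborel (I (t * r1) (t * r2) pp) \<le> ennreal t * emeasure lborel (I r1 r2 pp)" for pp
  proof (cases pp)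
    case (Pair p p')
    show ?thesis unfolding Pair I_eq times_divide_eq_right[symmetric] by (rule emeasure_Ioo_inter_scale[OF t])
  qed
  have tr: "t * r1 \<le> r1" "t * r2 \<le> r2"
    using t r mult_right_mono[of t 1 r1] mult_right_mono[of t 1 r2] by auto
  have I_sub: "I (t * r1) (t * r2) pp \<subseteq> I r1 r2 pp" for pp
    using tr unfolding I_def by (cases pp) (auto intro: order.strict_trans2)
  have disj: "disjoint_family_on (I r1 r2) K" for K
  unfolding disjoint_family_on_def
  proof (intro ballI impI)
    fix m n :: "int \<times> int"
    assume "m \<noteq> n"
    have False if "x \<in> I r1 r2 m" "x \<in> I r1 r2 n" for x
    proof -
      obtain p p' q q' where pq: "m = (p, p')" "n = (q, q')" by (cases m, cases n)
      \<comment> \<open>Radii of at most 1/2 keep pieces with different integer shifts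
        apart.\<close>
      have "\<bar>of_int (p - q) :: real\<bar> < 1" "\<bar>of_int (p' - q') :: real\<bar> < 1"
        using that r unfolding pq I_def by auto
      then have "p = q" "p' = q'" by linarith+
      then show False using \<open>m \<noteq> n\<close> pq by simp
    qed
    then show "I r1 r2 m \<inter> I r1 r2 n = {}" by auto
  qed
  have disj': "disjoint_family_on (I (t * r1) (t * r2)) K" for K
    using disj[of K] I_sub unfolding disjoint_family_on_def by blast
  define K where "K = {pp. I (t * r1) (t * r2) pp \<inter> {0..1} \<noteq> {}}"
  have "countable K" by (rule countable_subset[OF subset_UNIV]) simp
  have cover: "E (t * r1) (t * r2) \<inter> {0..1} \<subseteq> (\<Union>pp\<in>K. I (t * r1) (t * r2) pp)"
  proof
    fix x assume x: "x \<in> E (t * r1) (t * r2) \<inter> {0..1}"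
    then obtain p p' :: int where "\<bar>of_int a * x + of_int p - c1\<bar> < t * r1" "\<bar>of_int b * x + of_int p' - c2\<bar> < t * r2"
      unfolding E_def circ_arc_def by auto
    then have "x \<in> I (t * r1) (t * r2) (p, p')" unfolding I_def by simp
    then show "x \<in> (\<Union>pp\<in>K. I (t * r1) (t * r2) pp)" using x unfolding K_def by blast
  qed
  \<comment> \<open>An unscaled piece has length at most \<open>2 * r1 / |a|\<close>, hence at most
    1, so a piece that meets the unit interval stays within three periods.\<close>
  have inside: "(\<Union>pp\<in>K. I r1 r2 pp) \<subseteq> E r1 r2 \<inter> {-1..<-1 + real 3}"
  proof
    fix x assume "x \<in> (\<Union>pp\<in>K. I r1 r2 pp)"
    then obtain p p' where "(p, p') \<in> K" and x: "x \<in> I r1 r2 (p, p')" by auto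
    then obtain y where y: "y \<in> I (t * r1) (t * r2) (p, p')" "0 \<le> y" "y \<le> 1" unfolding K_def by auto
    have "\<bar>of_int a * (x - y)\<bar> < 1"
      using x subsetD[OF I_sub y(1)] r unfolding I_def by (simp add: algebra_simps) linarith
    moreover have "\<bar>x - y\<bar> \<le> \<bar>of_int a\<bar> * \<bar>x - y\<bar>"
    proof -
      have "(1::real) \<le> \<bar>of_int a\<bar>" using a by linarith
      then show ?thesis using mult_right_mono[of 1 "\<bar>of_int a :: real\<bar>" "\<bar>x - y\<bar>"] by simp
    qed
    ultimately have "\<bar>x - y\<bar> < 1" by (simp add: abs_mult)
    moreover have "x \<in> E r1 r2"
      using x unfolding I_def E_def circ_arc_def by auto
    ultimately show "x \<in> E r1 r2 \<inter> {-1..<-1 + real 3}" using y by auto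
  qed
  have per: "of_int a * (x + 1) \<in> circ_arc c r \<longleftrightarrow> of_int a * x \<in> circ_arc c r" for a :: int and x c r
    using periodic_of_int[of "\<lambda>x. x \<in> circ_arc c r" "of_int a * x" a] by (simp add: algebra_simps)
  have "emeasure unif (E (t * r1) (t * r2)) = emeasure lborel (E (t * r1) (t * r2) \<inter> {0..1})"
    by (rule emeasure_unif) simp
  also have "\<dots> \<le> emeasure lborel (\<Union>pp\<in>K. I (t * r1) (t * r2) pp)"
    using cover I_sets \<open>countable K\<close> by (intro emeasure_mono sets.countable_UN') auto
  also have "\<dots> = (\<integral>\<^sup>+pp. emeasure lborel (I (t * r1) (t * r2) pp) \<partial>count_space K)"
    using I_sets disj' \<open>countable K\<close> by (intro emeasure_UN_countable) auto
  also have "\<dots> \<le> (\<integral>\<^sup>+pp. ennreal t * emeasure lborel (I r1 r2 pp) \<partial>count_space K)"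
    by (intro nn_integral_mono I_scale)
  also have "\<dots> = ennreal t * (\<integral>\<^sup>+pp. emeasure lborel (I r1 r2 pp) \<partial>count_space K)"
    by (intro nn_integral_cmult) simp
  also have "(\<integral>\<^sup>+pp. emeasure lborel (I r1 r2 pp) \<partial>count_space K) = emeasure lborel (\<Union>pp\<in>K. I r1 r2 pp)"
    using I_sets disj \<open>countable K\<close> by (intro emeasure_UN_countable[symmetric]) auto
  also have "\<dots> \<le> emeasure lborel (E r1 r2 \<inter> {-1..<-1 + real 3})"
    using inside by (intro emeasure_mono) auto
  also have "\<dots> = (\<integral>\<^sup>+x. indicator (E r1 r2 \<inter> {-1..<-1 + real 3}) x \<partial>lborel)"
    by (intro nn_integral_indicator[symmetric]) auto
  also have "\<dots> = (\<integral>\<^sup>+x. indicator (E r1 r2) x * indicator {-1..<-1 + real 3} x \<partial>lborel)"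
    by (intro nn_integral_cong) (simp add: indicator_inter_arith)
  also have "\<dots> = of_nat 3 * (\<integral>\<^sup>+x. indicator (E r1 r2) x \<partial>unif)"
    by (intro nn_integral_interval_periodic) (auto simp: indicator_def E_def per)
  also have "(\<integral>\<^sup>+x. indicator (E r1 r2) x \<partial>unif) = emeasure unif (E r1 r2)"
    by (intro nn_integral_indicator) simp
  finally have "emeasure unif (E (t * r1) (t * r2)) \<le> ennreal t * (of_nat 3 * emeasure unif (E r1 r2))"
    by (simp add: mult_left_mono)
  also have "\<dots> = ennreal (3 * t * measure unif (E r1 r2))"
    using t by (simp add: unif.emeasure_eq_measure ennreal_mult' mult_ac)
  finally show ?thesis
    using t unfolding corr_def E_def[symmetric] by (simp add: unif.emeasure_eq_measure)
qed

section \<open>Integer vectors of given norm and sums over pairs\<close>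

definition zsphere :: "nat \<Rightarrow> nat \<Rightarrow> (nat \<Rightarrow> int) set" where
  "zsphere n s = {q \<in> zvecs n. normv n q = s}"

definition zball :: "nat \<Rightarrow> nat \<Rightarrow> (nat \<Rightarrow> int) set" where
  "zball n s = {q \<in> zvecs n. \<forall>i<n. \<bar>q i\<bar> \<le> int s}"

lemma normv_le_iff:
  assumes "n \<ge> 1"
  shows "normv n q \<le> s \<longleftrightarrow> (\<forall>i<n. \<bar>q i\<bar> \<le> int s)"
proof -
  have "(\<lambda>i. \<bar>q i\<bar>) ` {..<n} \<noteq> {}" using assms by (simp add: lessThan_empty_iff)
  then show ?thesis unfolding normv_def nat_le_iff by (subst Max_le_iff) auto
qed

lemma normv_attained:
  assumes "n \<ge> 1"
  obtains i where "i < n" "\<bar>q i\<bar> = int (normv n q)"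
proof -
  have "Max ((\<lambda>i. \<bar>q i\<bar>) ` {..<n}) \<in> (\<lambda>i. \<bar>q i\<bar>) ` {..<n}"
    using assms by (intro Max_in) (simp_all add: lessThan_empty_iff)
  then obtain i where i: "i < n" "Max ((\<lambda>i. \<bar>q i\<bar>) ` {..<n}) = \<bar>q i\<bar>" by auto
  then show ?thesis using that[of i] by (simp add: normv_def)
qed

lemma abs_le_normv: "i < n \<Longrightarrow> \<bar>q i\<bar> \<le> int (normv n q)"
  using normv_le_iff[of n q "normv n q"] by auto

lemma normv_eqI:
  assumes "i < n" "\<bar>q i\<bar> = int s" "\<And>i. i < n \<Longrightarrow> \<bar>q i\<bar> \<le> int s"
  shows "normv n q = s"
  using assms normv_le_iff[of n q s] abs_le_normv[of i n q] by force

lemma zball_eq: "n \<ge> 1 \<Longrightarrow> zball n s = {q \<in> zvecs n. normv n q \<le> s}"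
  by (auto simp: zball_def normv_le_iff)

text \<open>Members of \<open>zvecs\<close> vanish beyond \<open>n\<close>, extensional functions
  are \<open>undefined\<close> there. The bijection exchanges the two conventions so that
  \<open>card_PiE\<close> applies.\<close>

lemma bij_betw_zball: "bij_betw (\<lambda>q. restrict q {..<n}) (zball n s) (PiE {..<n} (\<lambda>_. {- int s..int s}))"
proof (rule bij_betw_byWitness[where f'="\<lambda>q i. if i < n then q i else 0"])
  show "\<forall>q\<in>zball n s. (\<lambda>i. if i < n then restrict q {..<n} i else 0) = q"
    by (auto simp: zball_def zvecs_def fun_eq_iff)
  show "\<forall>q\<in>PiE {..<n} (\<lambda>_. {- int s..int s}). restrict (\<lambda>i. if i < n then q i else 0) {..<n} = q"
  proof
    fix q assume q: "q \<in> PiE {..<n} (\<lambda>_. {- int s..int s})"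
    show "restrict (\<lambda>i. if i < n then q i else 0) {..<n} = q"
      by (rule ext) (use PiE_arb[OF q] in \<open>auto simp: restrict_def\<close>)
  qed
  show "(\<lambda>q. restrict q {..<n}) ` zball n s \<subseteq> PiE {..<n} (\<lambda>_. {- int s..int s})"
  proof (rule image_subsetI)
    fix q assume "q \<in> zball n s"
    have "q i \<in> {- int s..int s}" if "i \<in> {..<n}" for i
    proof -
      have "\<bar>q i\<bar> \<le> int s" using \<open>q \<in> zball n s\<close> that by (simp add: zball_def)
      then show ?thesis unfolding atLeastAtMost_iff by linarith
    qed
    then show "restrict q {..<n} \<in> PiE {..<n} (\<lambda>_. {- int s..int s})"
      unfolding restrict_PiE_iff by (rule ballI)
  qed
  show "(\<lambda>q i. if i < n then q i else 0) ` PiE {..<n} (\<lambda>_. {- int s..int s}) \<subseteq> zball n s"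
  proof (rule image_subsetI)
    fix q assume q: "q \<in> PiE {..<n} (\<lambda>_. {- int s..int s})"
    have "\<bar>q i\<bar> \<le> int s" if "i < n" for i
    proof -
      have "q i \<in> {- int s..int s}" using PiE_mem[OF q, of i] that by blast
      then show ?thesis unfolding atLeastAtMost_iff by linarith
    qed
    then show "(\<lambda>i. if i < n then q i else 0) \<in> zball n s"
      by (simp add: zball_def zvecs_def)
  qed
qed

lemma finite_zball [simp]: "finite (zball n s)"
  using bij_betw_finite[OF bij_betw_zball] by (simp add: finite_PiE)

lemma card_zball: "card (zball n s) = (2 * s + 1) ^ n"
proof -
  have "card (zball n s) = card {- int s..int s} ^ n"
    using bij_betw_same_card[OF bij_betw_zball] by (simp add: card_PiE)
  also have "card {- int s..int s} = 2 * s + 1" by simp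
  finally show ?thesis .
qed

lemma finite_zsphere [simp]: "n \<ge> 1 \<Longrightarrow> finite (zsphere n s)"
  by (rule finite_subset[OF _ finite_zball[of n s]]) (auto simp: zball_eq zsphere_def)

lemma card_zsphere:
  assumes "n \<ge> 1" "s \<ge> 1"
  shows "real (card (zsphere n s)) = (2 * real s + 1) ^ n - (2 * real s - 1) ^ n"
proof -
  have "zsphere n s = zball n s - zball n (s - 1)"
    using assms by (auto simp: zball_eq zsphere_def)
  moreover have "zball n (s - 1) \<subseteq> zball n s" using assms by (auto simp: zball_eq)
  ultimately have "card (zsphere n s) + card (zball n (s - 1)) = card (zball n s)"
    by (simp add: card_Diff_subset card_mono)
  moreover have "real (card (zball n (s - 1))) = (2 * real s - 1) ^ n"
    using assms by (simp add: card_zball of_nat_diff)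
  moreover have "real (card (zball n s)) = (2 * real s + 1) ^ n"
    by (simp add: card_zball add.commute)
  ultimately show ?thesis by linarith
qed

text \<open>For \<open>x = 2 * s\<close> the left side counts vectors of norm \<open>s\<close> in
  dimension \<open>n + 1\<close>. Either the first \<open>n\<close> entries already have norm
  \<open>s\<close> and the last is one of \<open>x + 1\<close> values, or the last is
  \<open>s\<close> or \<open>-s\<close> and the others are smaller in absolute value.\<close>

lemma power_shell_Suc: "(x + 1) ^ Suc n - (x - 1) ^ Suc n = (x + 1) * ((x + 1) ^ n - (x - 1) ^ n) + 2 * (x - 1) ^ n"
  for x :: real
  by (simp add: algebra_simps)

text \<open>For \<open>x = 2 * s\<close> the left side counts the vectors whose first entry is
  \<open>s\<close> or \<open>-s\<close>.\<close>

lemma power_shell_lower: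
  fixes x :: real
  assumes "x \<ge> 1" "n \<ge> 1"
  shows "2 * (x + 1) ^ (n - 1) \<le> (x + 1) ^ n - (x - 1) ^ n"
proof -
  obtain j where j: "n = Suc j" using assms by (cases n) auto
  have "(x - 1) * (x - 1) ^ j \<le> (x - 1) * (x + 1) ^ j"
    using assms by (intro mult_left_mono power_mono) auto
  then show ?thesis by (simp add: j algebra_simps)
qed

text \<open>When one of the balls is large, this replaces the count for the gcd by the count for
  \<open>s\<close> or \<open>t\<close>.\<close>

lemma card_zsphere_mono:
  assumes "n \<ge> 1" "1 \<le> s" "s \<le> t"
  shows "real (card (zsphere n s)) \<le> real (card (zsphere n t))"
proof -
  have nn: "(x - 1) ^ n \<le> (x + 1) ^ n" if "x \<ge> 1" for x :: real and n
    using that by (intro power_mono) auto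
  have "(x + 1) ^ n - (x - 1) ^ n \<le> (y + 1) ^ n - (y - 1) ^ n" if "1 \<le> x" "x \<le> y" for x y :: real
  proof (induction n)
    case (Suc n)
    have "(x - 1) ^ n \<le> (y - 1) ^ n" using that by (intro power_mono) auto
    moreover have "(x + 1) * ((x + 1) ^ n - (x - 1) ^ n) \<le> (y + 1) * ((y + 1) ^ n - (y - 1) ^ n)"
      using that nn[of x n] by (intro mult_mono Suc) auto
    ultimately show ?case unfolding power_shell_Suc by linarith
  qed simp
  from this[of "2 * real s" "2 * real t"] show ?thesis
    using assms by (simp add: card_zsphere)
qed

lemma card_zsphere_ge_1:
  assumes "n \<ge> 1" "s \<ge> 1"
  shows "1 \<le> real (card (zsphere n s))"
proof -
  have "1 \<le> (2 * real s + 1) ^ (n - 1)" by (intro one_le_power) simp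
  then show ?thesis
    using power_shell_lower[of "2 * real s" n] assms unfolding card_zsphere[OF assms] by linarith
qed

text \<open>The vectors whose first \<open>n\<close> entries are smaller than \<open>s\<close> are
  at most as many as the bound \<open>(2 s + 1) N\<close> for the others, and
  \<open>2 (2 s + 1) <= 6 s\<close>; this is the origin of the 6.\<close>

lemma card_zsphere_Suc:
  assumes "n \<ge> 1" "s \<ge> 1"
  shows "real s * real (card (zsphere n s)) \<le> real (card (zsphere (Suc n) s))"
    and "real (card (zsphere (Suc n) s)) \<le> 6 * real s * real (card (zsphere n s))"
proof -
  let ?x = "2 * real s" and ?N = "real (card (zsphere n s))"
  have N: "real (card (zsphere (Suc n) s)) = (?x + 1) * ?N + 2 * (?x - 1) ^ n"
    using assms by (simp only: card_zsphere power_shell_Suc)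
  have x: "?x \<ge> 1" using assms by simp
  have "0 \<le> (?x - 1) ^ n" using x by simp
  moreover have "real s * ?N \<le> (?x + 1) * ?N" by (intro mult_right_mono) auto
  ultimately show "real s * ?N \<le> real (card (zsphere (Suc n) s))" unfolding N by linarith
  have "(?x - 1) ^ n \<le> (?x + 1) ^ n" using x by (intro power_mono) auto
  also have "\<dots> = (?x + 1) * (?x + 1) ^ (n - 1)" using assms by (cases n) auto
  finally have "2 * (?x - 1) ^ n \<le> (?x + 1) * (2 * (?x + 1) ^ (n - 1))" by simp
  also have "\<dots> \<le> (?x + 1) * ?N"
    using power_shell_lower[OF x assms(1)] x assms by (intro mult_left_mono) (auto simp: card_zsphere)
  finally have "real (card (zsphere (Suc n) s)) \<le> 2 * (?x + 1) * ?N" unfolding N by (simp add: algebra_simps)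
  also have "\<dots> \<le> 6 * real s * ?N" using assms by (intro mult_right_mono) auto
  finally show "real (card (zsphere (Suc n) s)) \<le> 6 * real s * ?N" .
qed

lemma card_zsphere_add:
  assumes "n \<ge> 1" "s \<ge> 1"
  shows "real s ^ k * real (card (zsphere n s)) \<le> real (card (zsphere (n + k) s))"
    and "real (card (zsphere (n + k) s)) \<le> (6 * real s) ^ k * real (card (zsphere n s))"
proof (induction k)
  case (Suc k)
  {
    case 1
    have "real s ^ Suc k * real (card (zsphere n s)) \<le> real s * real (card (zsphere (n + k) s))"
      using Suc(1) mult_left_mono[OF Suc(1), of "real s"] by (simp add: mult.assoc)
    also have "\<dots> \<le> real (card (zsphere (n + Suc k) s))"
      using card_zsphere_Suc(1)[of "n + k" s] assms by simp
    finally show ?case .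
  next
    case 2
    have "real (card (zsphere (n + Suc k) s)) \<le> 6 * real s * real (card (zsphere (n + k) s))"
      using card_zsphere_Suc(2)[of "n + k" s] assms by simp
    also have "\<dots> \<le> 6 * real s * ((6 * real s) ^ k * real (card (zsphere n s)))"
      by (intro mult_left_mono Suc) auto
    finally show ?case by (simp add: mult.assoc)
  }
qed simp_all

section \<open>Pairs of vectors of prescribed norms: independent and parallel ones\<close>

definition pair_meas :: "nat \<Rightarrow> nat \<Rightarrow> tball \<Rightarrow> tball \<Rightarrow> (nat \<Rightarrow> int) \<Rightarrow> (nat \<Rightarrow> int) \<Rightarrow> real" where
  "pair_meas n m B1 B2 q1 q2 = measure (matmeas n m) (Aset n m q1 B1 \<inter> Aset n m q2 B2)"

definition pair_sum :: "nat \<Rightarrow> nat \<Rightarrow> tball \<Rightarrow> tball \<Rightarrow> nat \<Rightarrow> nat \<Rightarrow> real" where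
  "pair_sum n m B1 B2 s t = (\<Sum>(q1, q2)\<in>zsphere n s \<times> zsphere n t. pair_meas n m B1 B2 q1 q2)"

definition ball_corr :: "nat \<Rightarrow> int \<Rightarrow> int \<Rightarrow> tball \<Rightarrow> tball \<Rightarrow> real" where
  "ball_corr m a b B1 B2 = (\<Prod>j<m. corr a b (circ_arc (fst B1 j) (snd B1)) (circ_arc (fst B2 j) (snd B2)))"

lemma pair_meas_nonneg [simp]: "0 \<le> pair_meas n m B1 B2 q1 q2"
  by (simp add: pair_meas_def)

lemma tball_vol_nonneg [simp]: "0 \<le> tball_vol m B"
  by (simp add: tball_vol_def)

lemma corr_nonneg [simp]: "0 \<le> corr a b S T"
  by (simp add: corr_def)

lemma ball_corr_nonneg [simp]: "0 \<le> ball_corr m a b B1 B2"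
  by (simp add: ball_corr_def prod_nonneg)

lemma pair_meas_independent:
  assumes "i < n" "j < n" "q2 j \<noteq> 0" "q1 i * q2 j \<noteq> q1 j * q2 i"
  shows "pair_meas n m B1 B2 q1 q2 = tball_vol m B1 * tball_vol m B2"
  unfolding pair_meas_def measure_Aset_inter measure_strip_independent[OF assms] tball_vol_eq
  by (simp add: prod.distrib)

lemma pair_meas_parallel:
  assumes "i < n" "u i \<noteq> 0"
  shows "pair_meas n m B1 B2 (\<lambda>l. a * u l) (\<lambda>l. b * u l) = ball_corr m a b B1 B2"
  unfolding pair_meas_def measure_Aset_inter measure_strip_parallel[of i n u, OF assms] ball_corr_def ..

lemma zsphere_nonzero:
  assumes "n \<ge> 1" "s \<ge> 1" "u \<in> zsphere n s"
  obtains i where "i < n" "u i \<noteq> 0"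
proof -
  obtain i where "i < n" "\<bar>u i\<bar> = int (normv n u)"
    using normv_attained[OF assms(1)] by blast
  then show ?thesis using assms that[of i] by (auto simp: zsphere_def)
qed

lemma zsphere_mult:
  assumes "n \<ge> 1" "u \<in> zsphere n s"
  shows "(\<lambda>l. a * u l) \<in> zsphere n (nat \<bar>a\<bar> * s)"
proof -
  obtain i where "i < n" "\<bar>u i\<bar> = int (normv n u)"
    using normv_attained[OF assms(1)] by blast
  then have "normv n (\<lambda>l. a * u l) = nat \<bar>a\<bar> * s"
    using assms abs_le_normv[of _ n u]
    by (intro normv_eqI[of i]) (auto simp: zsphere_def abs_mult intro!: mult_left_mono)
  then show ?thesis using assms by (auto simp: zsphere_def zvecs_def)
qed

text \<open>Where \<open>q2\<close> attains its norm, \<open>q1\<close> does so too, so the ratio of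
  the vectors is \<open>s / t\<close> up to a sign \<open>e\<close>. In lowest terms this is
  \<open>a / b\<close>; being coprime to \<open>a\<close>, the number \<open>b\<close> divides every
  entry of \<open>q2\<close>, and the quotient \<open>u\<close> has norm \<open>gcd s t\<close>. The
  vector \<open>u\<close> need not be primitive, which is why its norm is the full gcd.\<close>

lemma parallel_obtain:
  assumes n: "n \<ge> 1" and st: "s \<ge> 1" "t \<ge> 1" and q: "q1 \<in> zsphere n s" "q2 \<in> zsphere n t"
    and par: "\<And>i j. i < n \<Longrightarrow> j < n \<Longrightarrow> q2 j \<noteq> 0 \<Longrightarrow> q1 i * q2 j = q1 j * q2 i"
  obtains u e where "u \<in> zsphere n (gcd s t)" "e \<in> {1, -1::int}"
    "q1 = (\<lambda>l. e * int (s div gcd s t) * u l)" "q2 = (\<lambda>l. int (t div gcd s t) * u l)"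
proof -
  define g where "g = gcd s t"
  define a where "a = s div g"
  define b where "b = t div g"
  have g: "g > 0" using st by (simp add: g_def)
  have sa: "s = a * g" and tb: "t = b * g" by (simp_all add: a_def b_def g_def)
  have b0: "b > 0" using st tb by (cases b) auto
  have cop: "coprime a b" unfolding a_def b_def g_def using st by (intro div_gcd_coprime) auto
  obtain j where j: "j < n" "\<bar>q2 j\<bar> = int t"
    using normv_attained[OF n, of q2] q by (auto simp: zsphere_def)
  obtain i0 where i0: "i0 < n" "\<bar>q1 i0\<bar> = int s"
    using normv_attained[OF n, of q1] q by (auto simp: zsphere_def)
  have q2j: "q2 j \<noteq> 0" using j st by auto
  \<comment> \<open>Parallelism is tested at a coordinate \<open>i0\<close> where \<open>q1\<close>
    attains its norm; this forces \<open>q1 j\<close> to be as large as possible.\<close>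
  have "int s * int t = \<bar>q1 j\<bar> * \<bar>q2 i0\<bar>"
    using par[OF i0(1) j(1) q2j] i0(2) j(2) by (metis abs_mult)
  also have "\<dots> \<le> \<bar>q1 j\<bar> * int t"
    using abs_le_normv[OF i0(1), of q2] q by (intro mult_left_mono) (auto simp: zsphere_def)
  finally have "int s \<le> \<bar>q1 j\<bar>" using st by simp
  then have q1j: "\<bar>q1 j\<bar> = int s"
    using abs_le_normv[OF j(1), of q1] q by (simp add: zsphere_def)
  define e where "e = sgn (q1 j) * sgn (q2 j)"
  have e: "e \<in> {1, -1}" using q1j q2j st by (auto simp: e_def sgn_if)
  have ta: "q1 i * int t = e * int s * q2 i" for i
  proof (cases "i < n")
    case True
    have "q1 i * (sgn (q2 j) * int t) = sgn (q1 j) * int s * q2 i"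
      using par[OF True j(1) q2j] j(2) q1j by (metis mult_sgn_abs)
    then have "sgn (q2 j) * (q1 i * (sgn (q2 j) * int t)) = sgn (q2 j) * (sgn (q1 j) * int s * q2 i)"
      by simp
    moreover have "sgn (q2 j) * sgn (q2 j) = 1" using q2j by (simp add: sgn_if)
    ultimately show ?thesis
      unfolding e_def by (metis (no_types, opaque_lifting) mult.assoc mult.left_commute mult_1)
  next
    case False
    then show ?thesis using q by (simp add: zsphere_def zvecs_def)
  qed
  have ab: "int b * q1 i = e * int a * q2 i" for i
    using ta[of i] g unfolding sa tb by (simp add: mult_ac)
  have bd: "int b dvd q2 i" for i
  proof -
    have "int b dvd int a * (e * q2 i)" using ab[of i] by (metis dvd_triv_left mult.left_commute mult.assoc)
    then have "int b dvd e * q2 i" using cop by (simp add: coprime_dvd_mult_right_iff coprime_commute)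
    then show ?thesis using e by auto
  qed
  define u where "u i = q2 i div int b" for i
  have u2: "q2 i = int b * u i" for i using bd[of i] by (simp add: u_def)
  have u1: "q1 i = e * int a * u i" for i
    using ab[of i] b0 unfolding u2 by (simp add: mult_ac)
  have "\<bar>u i\<bar> \<le> int g" if "i < n" for i
  proof -
    have "int b * \<bar>u i\<bar> \<le> int b * int g"
      using abs_le_normv[OF that, of q2] q tb by (simp add: zsphere_def u2 abs_mult)
    then show ?thesis using b0 by simp
  qed
  moreover have "\<bar>u j\<bar> = int g"
    using j(2) b0 unfolding u2 tb by (simp add: abs_mult)
  ultimately have "normv n u = g" using j(1) by (intro normv_eqI[of j]) auto
  moreover have "u \<in> zvecs n" using q by (auto simp: zvecs_def zsphere_def u_def)
  ultimately have "u \<in> zsphere n (gcd s t)" by (simp add: zsphere_def g_def)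
  then show ?thesis
    using that[of u e] e u1 u2 unfolding a_def b_def g_def by (simp add: fun_eq_iff)
qed

text \<open>A pair with a nonzero minor contributes the product of the volumes, and letting all
  pairs do so only adds nonnegative terms. The others are given by \<open>parallel_obtain\<close>
  through a sign and a vector of norm \<open>gcd s t\<close>, and their measure depends on the sign
  alone.\<close>

lemma pair_sum_le:
  assumes n: "n \<ge> 1" and st: "s \<ge> 1" "t \<ge> 1"
  shows "pair_sum n m B1 B2 s t \<le> real (card (zsphere n s)) * tball_vol m B1 * (real (card (zsphere n t)) * tball_vol m B2)
    + real (card (zsphere n (gcd s t))) * (\<Sum>e\<in>{1, -1}. ball_corr m (e * int (s div gcd s t)) (int (t div gcd s t)) B1 B2)"
proof -
  let ?S = "zsphere n s \<times> zsphere n t" and ?g = "gcd s t"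
  let ?f = "\<lambda>(q1, q2). pair_meas n m B1 B2 q1 q2"
  define P where "P = {(q1, q2) \<in> ?S. \<forall>i j. i < n \<longrightarrow> j < n \<longrightarrow> q2 j \<noteq> 0 \<longrightarrow> q1 i * q2 j = q1 j * q2 i}"
  define h where "h = (\<lambda>(e, u). ((\<lambda>l. e * int (s div ?g) * u l), (\<lambda>l::nat. int (t div ?g) * u l :: int)))"
  let ?I = "{1, -1::int} \<times> zsphere n ?g"
  have fin: "finite ?S" "finite ?I" using n by auto
  have PS: "P \<subseteq> ?S" by (auto simp: P_def)
  have g: "?g \<ge> 1" using st by (simp add: Suc_le_eq)
  have "pair_sum n m B1 B2 s t = sum ?f (?S - P) + sum ?f P"
    unfolding pair_sum_def using sum.subset_diff[OF PS fin(1)] by simp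
  also have "sum ?f (?S - P) \<le> (\<Sum>_\<in>?S. tball_vol m B1 * tball_vol m B2)"
  proof -
    have "sum ?f (?S - P) \<le> (\<Sum>_\<in>?S - P. tball_vol m B1 * tball_vol m B2)"
    proof (rule sum_mono)
      fix x assume "x \<in> ?S - P"
      then obtain q1 q2 i j where "x = (q1, q2)" "i < n" "j < n" "q2 j \<noteq> 0" "q1 i * q2 j \<noteq> q1 j * q2 i"
        unfolding P_def by auto
      then show "?f x \<le> tball_vol m B1 * tball_vol m B2" using pair_meas_independent[of i n j q2 q1] by simp
    qed
    also have "\<dots> \<le> (\<Sum>_\<in>?S. tball_vol m B1 * tball_vol m B2)"
      using fin(1) by (intro sum_mono2) auto
    finally show ?thesis .
  qed
  also have "sum ?f P \<le> sum ?f (h ` ?I)"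
  proof (rule sum_mono2)
    show "P \<subseteq> h ` ?I"
    proof
      fix x assume "x \<in> P"
      then obtain q1 q2 where x: "x = (q1, q2)" "q1 \<in> zsphere n s" "q2 \<in> zsphere n t"
        "\<And>i j. i < n \<Longrightarrow> j < n \<Longrightarrow> q2 j \<noteq> 0 \<Longrightarrow> q1 i * q2 j = q1 j * q2 i" unfolding P_def by auto
      from parallel_obtain[OF n st x(2,3,4)] obtain u e where ue: "u \<in> zsphere n ?g" "e \<in> {1, -1::int}"
        "q1 = (\<lambda>l. e * int (s div ?g) * u l)" "q2 = (\<lambda>l. int (t div ?g) * u l)" .
      have "x = h (e, u)" using ue x(1) by (simp add: h_def)
      then show "x \<in> h ` ?I" using ue(1,2) by blast
    qed
    show "0 \<le> ?f x" if "x \<in> h ` ?I - P" for x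
      by (cases x) simp
    show "finite (h ` ?I)" using fin(2) by (rule finite_imageI)
  qed
  also have "sum ?f (h ` ?I) \<le> sum (?f \<circ> h) ?I"
  proof (rule sum_image_le)
    show "0 \<le> ?f (h x)" for x by (cases "h x") simp
  qed (fact fin(2))
  also have "sum (?f \<circ> h) ?I = (\<Sum>(e, u)\<in>?I. ball_corr m (e * int (s div ?g)) (int (t div ?g)) B1 B2)"
  proof (intro sum.cong refl)
    fix x assume "x \<in> ?I"
    then obtain e u where x: "x = (e, u)" "u \<in> zsphere n ?g" by auto
    then obtain i where "i < n" "u i \<noteq> 0" using zsphere_nonzero[OF n g] by blast
    then show "(?f \<circ> h) x = (case x of (e, u) \<Rightarrow> ball_corr m (e * int (s div ?g)) (int (t div ?g)) B1 B2)"
      using pair_meas_parallel[of i n u] by (simp add: x(1) h_def)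
  qed
  also have "\<dots> = real (card (zsphere n ?g)) * (\<Sum>e\<in>{1, -1}. ball_corr m (e * int (s div ?g)) (int (t div ?g)) B1 B2)"
    by (subst sum.cartesian_product[symmetric]) (simp add: distrib_left)
  finally show ?thesis by (simp add: card_cartesian_product mult_ac)
qed

text \<open>In dimension \<open>n\<close> the correlations must be bounded by the given denominator,
  of which these parallel pairs form a part. Applying the bound once for each sign puts the factor 2
  into the final constant.\<close>

lemma pair_sum_ge:
  assumes n: "n \<ge> 1" and st: "s \<ge> 1" "t \<ge> 1" and e: "e \<in> {1, -1}"
  shows "real (card (zsphere n (gcd s t))) * ball_corr m (e * int (s div gcd s t)) (int (t div gcd s t)) B1 B2
    \<le> pair_sum n m B1 B2 s t"
proof -
  let ?S = "zsphere n s \<times> zsphere n t" and ?g = "gcd s t"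
  let ?f = "\<lambda>(q1, q2). pair_meas n m B1 B2 q1 q2"
  define h where "h u = ((\<lambda>l. e * int (s div ?g) * u l), (\<lambda>l. int (t div ?g) * u l))" for u :: "nat \<Rightarrow> int"
  have g: "?g \<ge> 1" using st by (simp add: Suc_le_eq)
  have b: "t div ?g > 0" using st by (simp add: div_greater_zero_iff gcd_le2_nat)
  have inj: "inj_on h (zsphere n ?g)"
    using b by (intro inj_onI) (auto simp: h_def fun_eq_iff)
  have sub: "h ` zsphere n ?g \<subseteq> ?S"
  proof
    fix x assume "x \<in> h ` zsphere n ?g"
    then obtain u where u: "u \<in> zsphere n ?g" "x = h u" by auto
    have "nat \<bar>e * int (s div ?g)\<bar> * ?g = s" "nat \<bar>int (t div ?g)\<bar> * ?g = t"
      using e by auto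
    then show "x \<in> ?S"
      using zsphere_mult[OF n u(1), of "e * int (s div ?g)"] zsphere_mult[OF n u(1), of "int (t div ?g)"]
      by (simp add: u(2) h_def)
  qed
  have "real (card (zsphere n ?g)) * ball_corr m (e * int (s div ?g)) (int (t div ?g)) B1 B2
     = sum (\<lambda>u. ?f (h u)) (zsphere n ?g)"
  proof -
    have "?f (h u) = ball_corr m (e * int (s div ?g)) (int (t div ?g)) B1 B2" if u: "u \<in> zsphere n ?g" for u
    proof -
      obtain i where "i < n" "u i \<noteq> 0" using zsphere_nonzero[OF n g u] .
      then show ?thesis using pair_meas_parallel[of i n u] by (simp add: h_def)
    qed
    then show ?thesis by simp
  qed
  also have "\<dots> = sum ?f (h ` zsphere n ?g)"
    by (simp add: sum.reindex[OF inj])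
  also have "\<dots> \<le> pair_sum n m B1 B2 s t"
    unfolding pair_sum_def using sub n by (intro sum_mono2) auto
  finally show ?thesis .
qed

section \<open>Numerator and denominator grouped by norms\<close>

lemma QIA_num_eq:
  assumes "n \<ge> 1"
  shows "QIA_num n m B Q = (\<Sum>s=1..Q. real (card (zsphere n s)) * tball_vol m (B s))"
proof -
  let ?S = "{q\<in>zvecs n. 1 \<le> normv n q \<and> normv n q \<le> Q}"
  have fin: "finite ?S" by (rule finite_subset[OF _ finite_zball[of n Q]]) (use assms in \<open>auto simp: zball_eq\<close>)
  have "QIA_num n m B Q = (\<Sum>s\<in>{1..Q}. \<Sum>q\<in>{q \<in> ?S. normv n q = s}. tball_vol m (B (normv n q)))"
    unfolding QIA_num_def using fin by (intro sum.group[symmetric]) auto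
  also have "\<dots> = (\<Sum>s=1..Q. real (card (zsphere n s)) * tball_vol m (B s))"
  proof (intro sum.cong refl)
    fix s assume "s \<in> {1..Q}"
    then have "{q \<in> ?S. normv n q = s} = zsphere n s" by (auto simp: zsphere_def)
    then show "(\<Sum>q\<in>{q \<in> ?S. normv n q = s}. tball_vol m (B (normv n q))) = real (card (zsphere n s)) * tball_vol m (B s)"
      by (simp add: zsphere_def)
  qed
  finally show ?thesis .
qed

lemma QIA_den_eq:
  assumes "n \<ge> 1"
  shows "QIA_den n m w B Q = (\<Sum>(s, t)\<in>{(s, t). 1 \<le> s \<and> s \<le> t \<and> t \<le> Q}.
     (real (gcd s t) / real s) powr w * pair_sum n m (B s) (scale_ball ((real s / real t) powr (w / real m)) (B t)) s t)"
proof -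
  let ?S = "{(q1, q2). q1 \<in> zvecs n \<and> q2 \<in> zvecs n \<and> 1 \<le> normv n q1 \<and> normv n q1 \<le> normv n q2 \<and> normv n q2 \<le> Q}"
  let ?T = "{(s, t). 1 \<le> s \<and> s \<le> t \<and> t \<le> Q}"
  let ?N = "\<lambda>(q1, q2). (normv n q1, normv n q2)"
  have fin: "finite ?S" by (rule finite_subset[OF _ finite_cartesian_product[OF finite_zball[of n Q] finite_zball[of n Q]]]) (use assms in \<open>auto simp: zball_eq\<close>)
  have finT: "finite ?T" by (rule finite_subset[of _ "{..Q} \<times> {..Q}"]) auto
  let ?h = "\<lambda>(q1, q2). (real (gcd (normv n q1) (normv n q2)) / real (normv n q1)) powr w *
     measure (matmeas n m)
       (Aset n m q1 (B (normv n q1)) \<inter>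
        Aset n m q2 (scale_ball ((real (normv n q1) / real (normv n q2)) powr (w / real m))
                                (B (normv n q2))))"
  have "QIA_den n m w B Q = (\<Sum>y\<in>?T. \<Sum>x\<in>{x \<in> ?S. ?N x = y}. ?h x)"
    unfolding QIA_den_def using fin finT by (intro sum.group[symmetric]) auto
  also have "\<dots> = (\<Sum>(s, t)\<in>?T.
     (real (gcd s t) / real s) powr w * pair_sum n m (B s) (scale_ball ((real s / real t) powr (w / real m)) (B t)) s t)"
  proof (intro sum.cong refl)
    fix y assume "y \<in> ?T"
    then obtain s t where y: "y = (s, t)" "1 \<le> s" "s \<le> t" "t \<le> Q" by auto
    have eq: "{x \<in> ?S. ?N x = y} = zsphere n s \<times> zsphere n t"
      using y by (auto simp: zsphere_def)
    have "(\<Sum>x\<in>zsphere n s \<times> zsphere n t. ?h x) = (real (gcd s t) / real s) powr w * pair_sum n m (B s) (scale_ball ((real s / real t) powr (w / real m)) (B t)) s t"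
      unfolding pair_sum_def sum_distrib_left
      by (intro sum.cong refl) (auto simp: zsphere_def pair_meas_def)
    then show "(\<Sum>x\<in>{x \<in> ?S. ?N x = y}. ?h x) = (case y of (s, t) \<Rightarrow>
     (real (gcd s t) / real s) powr w * pair_sum n m (B s) (scale_ball ((real s / real t) powr (w / real m)) (B t)) s t)"
      unfolding eq by (simp add: y(1))
  qed
  finally show ?thesis .
qed

section \<open>Passing to dimension n + k\<close>

lemma fst_scale_ball [simp]: "fst (scale_ball c B) = fst B"
  and snd_scale_ball [simp]: "snd (scale_ball c B) = c * snd B"
  by (simp_all add: scale_ball_def)

lemma scale_ball_scale_ball [simp]: "scale_ball c (scale_ball d B) = scale_ball (c * d) B"
  by (simp add: scale_ball_def mult.assoc)

lemma tball_vol_min: "snd B \<ge> 0 \<Longrightarrow> tball_vol m B = min 1 (2 * snd B) ^ m"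
  by (simp add: tball_vol_eq measure_circ_arc)

lemma tball_vol_scale_le:
  assumes "snd B \<ge> 0" "0 \<le> c" "c \<le> 1"
  shows "tball_vol m (scale_ball c B) \<le> tball_vol m B"
proof -
  have "c * snd B \<le> snd B" using assms by (simp add: mult_left_le_one_le)
  then show ?thesis using assms by (simp add: tball_vol_min power_mono)
qed

text \<open>Truncating the volume at 1 works in favour of this direction, so large radii are
  harmless here.\<close>

lemma tball_vol_scale_ge:
  assumes "snd B \<ge> 0" "0 \<le> c" "c \<le> 1"
  shows "c ^ m * tball_vol m B \<le> tball_vol m (scale_ball c B)"
proof -
  have "c * min 1 (2 * snd B) \<le> min 1 (2 * (c * snd B))"
    using assms mult_left_mono[of "min 1 (2 * snd B)" 1 c] mult_left_mono[of "min 1 (2 * snd B)" "2 * snd B" c] by auto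
  then have "(c * min 1 (2 * snd B)) ^ m \<le> min 1 (2 * (c * snd B)) ^ m"
    using assms by (intro power_mono) auto
  then show ?thesis using assms by (simp add: tball_vol_min power_mult_distrib)
qed

lemma ball_corr_le_left: "a \<noteq> 0 \<Longrightarrow> ball_corr m a b B1 B2 \<le> tball_vol m B1"
  unfolding ball_corr_def tball_vol_eq by (intro prod_mono) (simp add: corr_le_left)

lemma ball_corr_le_right: "b \<noteq> 0 \<Longrightarrow> ball_corr m a b B1 B2 \<le> tball_vol m B2"
  unfolding ball_corr_def tball_vol_eq by (intro prod_mono) (simp add: corr_le_right)

lemma ball_corr_diagonal: "ball_corr m 1 1 B B = tball_vol m B"
  by (simp add: ball_corr_def tball_vol_eq corr_def)

text \<open>A ball of very large radius still covers the torus after shrinking, and correlations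
  need not drop; hence the bounds on the radii.\<close>

lemma ball_corr_scale:
  assumes "a \<noteq> 0" "b \<noteq> 0" "0 \<le> c" "c \<le> 1" "0 \<le> snd B1" "snd B1 \<le> 1/2" "0 \<le> snd B2" "snd B2 \<le> 1/2"
  shows "ball_corr m a b (scale_ball c B1) (scale_ball c B2) \<le> (3 * c) ^ m * ball_corr m a b B1 B2"
proof -
  have "ball_corr m a b (scale_ball c B1) (scale_ball c B2)
     \<le> (\<Prod>j<m. (3 * c) * corr a b (circ_arc (fst B1 j) (snd B1)) (circ_arc (fst B2 j) (snd B2)))"
    unfolding ball_corr_def using corr_scale[OF assms] by (intro prod_mono) simp
  then show ?thesis by (simp add: ball_corr_def prod.distrib)
qed

lemma pair_meas_mono:
  assumes "fst B2 = fst B2'" "snd B2 \<le> snd B2'"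
  shows "pair_meas n m B1 B2 q1 q2 \<le> pair_meas n m B1 B2' q1 q2"
  unfolding pair_meas_def measure_Aset_inter
proof (intro prod_mono conjI)
  fix j
  have "strip n q1 q2 (circ_arc (fst B1 j) (snd B1)) (circ_arc (fst B2 j) (snd B2))
    \<subseteq> strip n q1 q2 (circ_arc (fst B1 j) (snd B1)) (circ_arc (fst B2' j) (snd B2'))"
    using circ_arc_mono[OF assms(2)] assms(1) by (auto simp: strip_def)
  then show "measure (cube {..<n}) (strip n q1 q2 (circ_arc (fst B1 j) (snd B1)) (circ_arc (fst B2 j) (snd B2)))
    \<le> measure (cube {..<n}) (strip n q1 q2 (circ_arc (fst B1 j) (snd B1)) (circ_arc (fst B2' j) (snd B2')))"
    by (intro finite_measure.finite_measure_mono finite_measure_cube strip_sets) auto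
qed simp

lemma pair_sum_mono:
  assumes "fst B2 = fst B2'" "snd B2 \<le> snd B2'"
  shows "pair_sum n m B1 B2 s t \<le> pair_sum n m B1 B2' s t"
  unfolding pair_sum_def using pair_meas_mono[of B2 B2' n m B1, OF assms] by (intro sum_mono) (simp add: case_prod_unfold)

lemma pair_sum_nonneg [simp]: "0 \<le> pair_sum n m B1 B2 s t"
  unfolding pair_sum_def by (intro sum_nonneg) auto

lemma gcd_div_le_1: "1 \<le> s \<Longrightarrow> 0 < real (gcd s t) / real s \<and> real (gcd s t) / real s \<le> 1" for s t :: nat
  by (simp add: gcd_le1_nat)

lemma QIA_den_nonneg: "0 \<le> QIA_den n m w B Q"
  unfolding QIA_den_def by (intro sum_nonneg) auto

text \<open>Weights and second radii are powers of numbers at most 1, so both decrease as the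
  exponent grows. This is what permits raising \<open>w\<close> to at least
  \<open>k\<close>.\<close>

lemma QIA_den_antimono:
  assumes n: "n \<ge> 1" and w: "w \<le> v" and B: "\<forall>q. snd (B q) \<ge> 0"
  shows "QIA_den n m v B Q \<le> QIA_den n m w B Q"
  unfolding QIA_den_eq[OF n]
proof (rule sum_mono)
  fix x assume "x \<in> {(s, t). 1 \<le> s \<and> s \<le> t \<and> t \<le> Q}"
  then obtain s t where x: "x = (s, t)" and st: "1 \<le> s" "s \<le> t" by auto
  have "(real s / real t) powr (v / real m) \<le> (real s / real t) powr (w / real m)"
    using st w by (intro powr_mono') (auto intro!: divide_right_mono)
  then have "pair_sum n m (B s) (scale_ball ((real s / real t) powr (v / real m)) (B t)) s t
     \<le> pair_sum n m (B s) (scale_ball ((real s / real t) powr (w / real m)) (B t)) s t"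
    using B by (intro pair_sum_mono) (auto intro: mult_right_mono)
  moreover have "(real (gcd s t) / real s) powr v \<le> (real (gcd s t) / real s) powr w"
    using gcd_div_le_1[OF st(1), of t] w by (intro powr_mono') auto
  ultimately show "(case x of (s, t) \<Rightarrow> (real (gcd s t) / real s) powr v *
       pair_sum n m (B s) (scale_ball ((real s / real t) powr (v / real m)) (B t)) s t)
     \<le> (case x of (s, t) \<Rightarrow> (real (gcd s t) / real s) powr w *
       pair_sum n m (B s) (scale_ball ((real s / real t) powr (w / real m)) (B t)) s t)"
    unfolding x prod.case by (intro mult_mono) auto
qed

lemma shrink_factor:
  assumes "m \<ge> 1" "s \<ge> 1"
  shows "0 < real s powr (- real k / real m)" "real s powr (- real k / real m) \<le> 1"
    "(real s powr (- real k / real m)) ^ m = 1 / real s ^ k"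
proof -
  show "0 < real s powr (- real k / real m)" using assms by simp
  have "real s powr (- real k / real m) \<le> real s powr 0"
    using assms by (intro powr_mono) auto
  then show "real s powr (- real k / real m) \<le> 1" using assms by simp
  have "(real s powr (- real k / real m)) ^ m = (real s powr (- real k / real m)) powr real m"
    using assms by (subst powr_realpow) auto
  also have "\<dots> = real s powr (- real k)" using assms by (simp add: powr_powr)
  also have "\<dots> = 1 / real s ^ k" using assms by (simp add: powr_minus_divide powr_realpow)
  finally show "(real s powr (- real k / real m)) ^ m = 1 / real s ^ k" .
qed

text \<open>The number of vectors grows at least by the factor \<open>s ^ k\<close>, while the
  volume drops at most by the same factor.\<close>

lemma shrunk_mass_ge:
  fixes B :: tball
  assumes "n \<ge> 1" "m \<ge> 1" "s \<ge> 1" "snd B \<ge> 0"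
  shows "real (card (zsphere n s)) * tball_vol m B
    \<le> real (card (zsphere (n + k) s)) * tball_vol m (scale_ball (real s powr (- real k / real m)) B)"
proof -
  note l = shrink_factor[OF assms(2,3), of k]
  have "real (card (zsphere n s)) * tball_vol m B
    = (real s ^ k * real (card (zsphere n s))) * ((real s powr (- real k / real m)) ^ m * tball_vol m B)"
    unfolding l(3) using assms by simp
  also have "\<dots> \<le> real (card (zsphere (n + k) s)) * tball_vol m (scale_ball (real s powr (- real k / real m)) B)"
    using l assms by (intro mult_mono card_zsphere_add(1) tball_vol_scale_ge) auto
  finally show ?thesis .
qed

text \<open>If both balls in dimension n have radius at most 1/2, the parallel pairs are controlled by
  their scaling behaviour. Otherwise one of the two norms already carries mass at least 1 in dimension
  n + k, so that even the trivial bound for the parallel pairs is dominated by the product.\<close>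

lemma weighted_pair_sum_le:
  fixes B :: "nat \<Rightarrow> tball" and v :: real
  assumes n: "n \<ge> 1" and m: "m \<ge> 1" and st: "1 \<le> s" "s \<le> t" and v: "real k \<le> v"
    and B: "\<forall>q. snd (B q) \<ge> 0"
  defines "B' \<equiv> \<lambda>q. scale_ball (real q powr (- real k / real m)) (B q)"
  defines "V \<equiv> \<lambda>q. real (card (zsphere (n + k) q)) * tball_vol m (B' q)"
  shows "(real (gcd s t) / real s) powr (v - real k) *
      pair_sum (n + k) m (B' s) (scale_ball ((real s / real t) powr ((v - real k) / real m)) (B' t)) s t
    \<le> 3 * (V s * V t) + 2 * 6 ^ k * 3 ^ m * ((real (gcd s t) / real s) powr v *
      pair_sum n m (B s) (scale_ball ((real s / real t) powr (v / real m)) (B t)) s t)"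
proof -
  define g where "g = gcd s t"
  define l where "l = real s powr (- real k / real m)"
  define u where "u = (real s / real t) powr (v / real m)"
  define d where "d = (real s / real t) powr ((v - real k) / real m)"
  define p where "p = pair_sum n m (B s) (scale_ball u (B t)) s t"
  define P where "P = (\<Sum>e\<in>{1, -1}. ball_corr m (e * int (s div g)) (int (t div g)) (B' s) (scale_ball d (B' t)))"
  define rho where "rho = real g / real s"
  have t1: "t \<ge> 1" using st by simp
  have Nk: "n + k \<ge> 1" using n by simp
  have g: "1 \<le> g" "g \<le> s" "g \<le> t" using st t1 by (auto simp: g_def Suc_le_eq gcd_le1_nat gcd_le2_nat)
  have ab: "s div g > 0" "t div g > 0" using g by (auto simp: div_greater_zero_iff)
  have rho: "0 < rho" "rho \<le> 1" using g st by (auto simp: rho_def)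
  note l_props = shrink_factor[OF m st(1), of k, folded l_def]
  have B'_nonneg: "snd (B' q) \<ge> 0" for q using B by (simp add: B'_def)
  have st_le: "real s / real t \<le> 1" "0 < real s / real t" using st by auto
  have d: "0 \<le> d" "d \<le> 1" using st_le v by (auto simp: d_def powr_le1)
  have u: "0 \<le> u" "u \<le> 1" using st_le v by (auto simp: u_def powr_le1)
  have V_nonneg: "0 \<le> V q" for q by (simp add: V_def)
  have vol_d: "tball_vol m (scale_ball d (B' t)) \<le> tball_vol m (B' t)"
    using d B'_nonneg by (intro tball_vol_scale_le)
  have P_nonneg: "0 \<le> P" unfolding P_def by (intro sum_nonneg) simp
  \<comment> \<open>The power of \<open>t\<close> cancels against the part of \<open>d\<close> with
    exponent \<open>- k / m\<close>, and both balls end up with the same factor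
    \<open>l\<close>.\<close>
  have radius: "d * (real t powr (- real k / real m)) = l * u"
  proof -
    have "d = (real s / real t) powr (v / real m) * (real s / real t) powr (- real k / real m)"
      unfolding d_def by (simp add: diff_divide_distrib flip: powr_add)
    also have "(real s / real t) powr (- real k / real m) = l / real t powr (- real k / real m)"
      unfolding l_def by (simp add: powr_divide)
    finally show ?thesis using t1 by (simp add: u_def)
  qed
  have second: "scale_ball d (B' t) = scale_ball l (scale_ball u (B t))"
    unfolding B'_def by (simp only: scale_ball_scale_ball radius)
  have first: "B' s = scale_ball l (B s)" by (simp add: B'_def l_def)
  \<comment> \<open>Such a ball has volume 1 and there is at least one vector of norm
    \<open>q\<close>.\<close>
  have V_ge_1: "1 \<le> V q" if "q \<ge> 1" "snd (B q) > 1/2" for q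
  proof -
    have "1 \<le> real (card (zsphere n q)) * tball_vol m (B q)"
      using card_zsphere_ge_1[OF n that(1)] that(2) by (simp add: tball_vol_min min_def)
    also have "\<dots> \<le> V q" unfolding V_def B'_def using that B by (intro shrunk_mass_ge n m) auto
    finally show ?thesis .
  qed
  have key: "rho powr (v - real k) * (real (card (zsphere (n + k) g)) * P)
     \<le> 2 * (V s * V t) + 2 * 6 ^ k * 3 ^ m * (rho powr v * p)"
  proof -
    have rp: "0 \<le> rho powr v * p" by (simp add: p_def)
    have le1: "rho powr (v - real k) \<le> 1" using rho v by (simp add: powr_le1)
    \<comment> \<open>The second radius is tested after the factor \<open>u\<close>, since
      \<open>scale_ball u (B t)\<close> is the second ball of the pair in dimension
      \<open>n\<close>.\<close>
    consider (left) "snd (B s) > 1/2" | (right) "u * snd (B t) > 1/2"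
      | (small) "snd (B s) \<le> 1/2" "u * snd (B t) \<le> 1/2" by linarith
    then show ?thesis
    proof cases
      case left
      \<comment> \<open>Bounding by the volume of the other ball leaves a factor 1 to spare, which
        \<open>V s\<close> then dominates.\<close>
      have "ball_corr m (e * int (s div g)) (int (t div g)) (B' s) (scale_ball d (B' t)) \<le> tball_vol m (B' t)" for e
        using ab by (intro order_trans[OF ball_corr_le_right vol_d]) simp
      then have "P \<le> (\<Sum>e\<in>{1, -1::int}. tball_vol m (B' t))"
        unfolding P_def by (intro sum_mono)
      then have "P \<le> 2 * tball_vol m (B' t)" by simp
      then have "real (card (zsphere (n + k) g)) * P \<le> real (card (zsphere (n + k) t)) * (2 * tball_vol m (B' t))"
        using card_zsphere_mono[OF Nk g(1) g(3)] P_nonneg by (intro mult_mono) auto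
      also have "\<dots> = 2 * (1 * V t)" by (simp add: V_def)
      also have "\<dots> \<le> 2 * (V s * V t)"
        using V_ge_1[OF st(1) left] V_nonneg by (intro mult_left_mono mult_right_mono) auto
      finally have "real (card (zsphere (n + k) g)) * P \<le> 2 * (V s * V t)" .
      then have "rho powr (v - real k) * (real (card (zsphere (n + k) g)) * P) \<le> 1 * (2 * (V s * V t))"
        by (rule mult_mono[OF le1]) (use P_nonneg in auto)
      then show ?thesis using rp by (simp add: add_increasing2)
    next
      case right
      have "u * snd (B t) \<le> snd (B t)" using u B by (simp add: mult_left_le_one_le)
      then have Vt: "1 \<le> V t" using right t1 by (intro V_ge_1) auto
      have "ball_corr m (e * int (s div g)) (int (t div g)) (B' s) (scale_ball d (B' t)) \<le> tball_vol m (B' s)"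
        if "e \<in> {1, -1}" for e
        using that ab by (intro ball_corr_le_left) auto
      then have "P \<le> (\<Sum>e\<in>{1, -1::int}. tball_vol m (B' s))"
        unfolding P_def by (intro sum_mono)
      then have "P \<le> 2 * tball_vol m (B' s)" by simp
      then have "real (card (zsphere (n + k) g)) * P \<le> real (card (zsphere (n + k) s)) * (2 * tball_vol m (B' s))"
        using card_zsphere_mono[OF Nk g(1) g(2)] P_nonneg by (intro mult_mono) auto
      also have "\<dots> = 2 * (V s * 1)" by (simp add: V_def)
      also have "\<dots> \<le> 2 * (V s * V t)"
        using Vt V_nonneg by (intro mult_left_mono) auto
      finally have "real (card (zsphere (n + k) g)) * P \<le> 2 * (V s * V t)" .
      then have "rho powr (v - real k) * (real (card (zsphere (n + k) g)) * P) \<le> 1 * (2 * (V s * V t))"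
        by (rule mult_mono[OF le1]) (use P_nonneg in auto)
      then show ?thesis using rp by (simp add: add_increasing2)
    next
      case small
      let ?J = "\<lambda>e. ball_corr m (e * int (s div g)) (int (t div g)) (B s) (scale_ball u (B t))"
      have each: "real (card (zsphere (n + k) g)) * ball_corr m (e * int (s div g)) (int (t div g)) (B' s) (scale_ball d (B' t))
          \<le> 6 ^ k * 3 ^ m * rho ^ k * p" if e: "e \<in> {1, -1}" for e
      proof -
        have "ball_corr m (e * int (s div g)) (int (t div g)) (B' s) (scale_ball d (B' t)) \<le> (3 * l) ^ m * ?J e"
          unfolding first second using small e ab l_props B u by (intro ball_corr_scale) auto
        then have "real (card (zsphere (n + k) g)) * ball_corr m (e * int (s div g)) (int (t div g)) (B' s) (scale_ball d (B' t))
          \<le> ((6 * real g) ^ k * real (card (zsphere n g))) * ((3 * l) ^ m * ?J e)"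
          using card_zsphere_add(2)[OF n g(1)] by (intro mult_mono) auto
        also have "\<dots> = 6 ^ k * 3 ^ m * rho ^ k * (real (card (zsphere n g)) * ?J e)"
          unfolding power_mult_distrib l_props(3) rho_def power_divide by simp
        also have "\<dots> \<le> 6 ^ k * 3 ^ m * rho ^ k * p"
          using pair_sum_ge[OF n st(1) t1 e] rho unfolding g_def p_def by (intro mult_left_mono) auto
        finally show ?thesis .
      qed
      have "real (card (zsphere (n + k) g)) * P \<le> (\<Sum>e\<in>{1, -1::int}. 6 ^ k * 3 ^ m * rho ^ k * p)"
        unfolding P_def sum_distrib_left by (intro sum_mono each)
      also have "\<dots> = 2 * 6 ^ k * 3 ^ m * (rho ^ k * p)" by simp
      finally have "rho powr (v - real k) * (real (card (zsphere (n + k) g)) * P)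
         \<le> rho powr (v - real k) * (2 * 6 ^ k * 3 ^ m * (rho ^ k * p))"
        by (intro mult_left_mono) auto
      also have "\<dots> = 2 * 6 ^ k * 3 ^ m * ((rho powr (v - real k) * rho powr real k) * p)"
        using rho by (simp add: powr_realpow)
      also have "rho powr (v - real k) * rho powr real k = rho powr v"
        by (simp flip: powr_add)
      finally show ?thesis using V_nonneg by (simp add: add_increasing)
    qed
  qed
  have "rho powr (v - real k) * pair_sum (n + k) m (B' s) (scale_ball d (B' t)) s t
     \<le> rho powr (v - real k) * (V s * V t + real (card (zsphere (n + k) g)) * P)"
  proof (intro mult_left_mono)
    have "pair_sum (n + k) m (B' s) (scale_ball d (B' t)) s t
      \<le> V s * (real (card (zsphere (n + k) t)) * tball_vol m (scale_ball d (B' t))) + real (card (zsphere (n + k) g)) * P"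
      unfolding V_def P_def g_def by (rule pair_sum_le[OF Nk st(1) t1])
    also have "V s * (real (card (zsphere (n + k) t)) * tball_vol m (scale_ball d (B' t))) \<le> V s * V t"
      using vol_d V_nonneg[of s] mult_left_mono[OF vol_d, of "real (card (zsphere (n + k) t))"]
      by (intro mult_left_mono) (simp_all add: V_def)
    finally show "pair_sum (n + k) m (B' s) (scale_ball d (B' t)) s t \<le> V s * V t + real (card (zsphere (n + k) g)) * P"
      by simp
  qed simp
  also have "\<dots> \<le> V s * V t + rho powr (v - real k) * (real (card (zsphere (n + k) g)) * P)"
    using rho v V_nonneg by (simp add: distrib_left powr_le1 mult_left_le_one_le)
  \<comment> \<open>One product stems from the independent pairs and two from
    \<open>key\<close>.\<close>
  also have "\<dots> \<le> 3 * (V s * V t) + 2 * 6 ^ k * 3 ^ m * (rho powr v * p)"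
    using key by simp
  finally show ?thesis unfolding rho_def g_def d_def p_def u_def .
qed

lemma QIA_den_shrunk_le:
  fixes B :: "nat \<Rightarrow> tball" and k :: nat and w :: real
  assumes n: "n \<ge> 1" and m: "m \<ge> 1" and B: "\<forall>q. snd (B q) \<ge> 0"
  defines "B' \<equiv> \<lambda>q. scale_ball (real q powr (- real k / real m)) (B q)"
  shows "QIA_den (n + k) m (max (w - real k) 0) B' Q
    \<le> 3 * (QIA_num (n + k) m B' Q)\<^sup>2 + 2 * 6 ^ k * 3 ^ m * QIA_den n m w B Q"
proof -
  \<comment> \<open>For \<open>w < k\<close> the exponent wanted is 0, which is \<open>v - k\<close>
    with \<open>v = k\<close>; so only exponents of at least \<open>k\<close> have to be
    treated.\<close>
  define v where "v = max w (real k)"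
  have v: "real k \<le> v" "w \<le> v" and vk: "max (w - real k) 0 = v - real k" by (auto simp: v_def)
  have Nk: "n + k \<ge> 1" using n by simp
  let ?T = "{(s, t). 1 \<le> s \<and> s \<le> t \<and> t \<le> Q}"
  define V where "V q = real (card (zsphere (n + k) q)) * tball_vol m (B' q)" for q
  have "QIA_den (n + k) m (v - real k) B' Q \<le> (\<Sum>(s, t)\<in>?T. 3 * (V s * V t) + 2 * 6 ^ k * 3 ^ m * ((real (gcd s t) / real s) powr v *
      pair_sum n m (B s) (scale_ball ((real s / real t) powr (v / real m)) (B t)) s t))"
    unfolding QIA_den_eq[OF Nk]
  proof (intro sum_mono)
    fix x assume "x \<in> ?T"
    then obtain s t where x: "x = (s, t)" "1 \<le> s" "s \<le> t" by auto
    show "(case x of (s, t) \<Rightarrow> (real (gcd s t) / real s) powr (v - real k) *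
        pair_sum (n + k) m (B' s) (scale_ball ((real s / real t) powr ((v - real k) / real m)) (B' t)) s t)
      \<le> (case x of (s, t) \<Rightarrow> 3 * (V s * V t) + 2 * 6 ^ k * 3 ^ m * ((real (gcd s t) / real s) powr v *
      pair_sum n m (B s) (scale_ball ((real s / real t) powr (v / real m)) (B t)) s t))"
      unfolding x(1) prod.case V_def B'_def by (rule weighted_pair_sum_le[OF n m x(2,3) v(1) B])
  qed
  also have "\<dots> = 3 * (\<Sum>(s, t)\<in>?T. V s * V t) + 2 * 6 ^ k * 3 ^ m * QIA_den n m v B Q"
    unfolding QIA_den_eq[OF n] by (simp add: case_prod_unfold sum.distrib sum_distrib_left)
  also have "(\<Sum>(s, t)\<in>?T. V s * V t) \<le> (\<Sum>(s, t)\<in>{1..Q} \<times> {1..Q}. V s * V t)"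
    by (intro sum_mono2) (auto simp: V_def)
  also have "\<dots> = (QIA_num (n + k) m B' Q)\<^sup>2"
    unfolding QIA_num_eq[OF Nk] V_def[symmetric] power2_eq_square sum_product by (rule sum.cartesian_product[symmetric])
  finally show ?thesis
    using QIA_den_antimono[OF n v(2) B, of m Q] unfolding vk
    by (simp add: mult_left_mono order_trans[OF _ add_left_mono])
qed

text \<open>Since division by 0 yields 0, a vanishing denominator would destroy the lower bound for
  the quotient. A norm \<open>s\<close> of positive mass prevents it: the pairs of equal vectors
  have weight 1 and the volume of the ball as measure.\<close>

lemma QIA_den_pos:
  assumes n: "n \<ge> 1" and num: "QIA_num n m B Q > 0"
  shows "QIA_den n m w B Q > 0"
proof -
  let ?T = "{(s, t). 1 \<le> s \<and> s \<le> t \<and> t \<le> Q}"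
  let ?f = "\<lambda>(s, t). (real (gcd s t) / real s) powr w * pair_sum n m (B s) (scale_ball ((real s / real t) powr (w / real m)) (B t)) s t"
  have finT: "finite ?T" by (rule finite_subset[of _ "{..Q} \<times> {..Q}"]) auto
  obtain s where s: "s \<in> {1..Q}" "0 < real (card (zsphere n s)) * tball_vol m (B s)"
    using num unfolding QIA_num_eq[OF n] by (meson not_le sum_nonpos)
  have "scale_ball 1 (B s) = B s" by (simp add: scale_ball_def)
  then have "0 < ?f (s, s)"
    using s pair_sum_ge[OF n, of s s 1 m "B s" "B s"] by (simp add: ball_corr_diagonal)
  also have "?f (s, s) \<le> sum ?f ?T"
    using s finT by (intro member_le_sum) auto
  finally show ?thesis unfolding QIA_den_eq[OF n] .
qed

theorem mainTheorem11:
  fixes n m k :: nat and w :: real and B :: "nat \<Rightarrow> tball"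
  assumes "n \<ge> 1" and "m \<ge> 1" and "w \<ge> 0"
    and "\<forall>q. snd (B q) \<ge> 0"
    and "wQIA n m w B"
  shows "wQIA (n + k) m (max (w - real k) 0)
           (\<lambda>q. scale_ball (real q powr (- real k / real m)) (B q))"
proof -
  define B' where "B' = (\<lambda>q. scale_ball (real q powr (- real k / real m)) (B q))"
  define w' where "w' = max (w - real k) 0"
  define C where "C = (2 * 6 ^ k * 3 ^ m :: real)"
  define f where "f Q = (QIA_num n m B Q)\<^sup>2 / QIA_den n m w B Q" for Q
  define f' where "f' Q = (QIA_num (n + k) m B' Q)\<^sup>2 / QIA_den (n + k) m w' B' Q" for Q
  have C: "C > 0" by (simp add: C_def)
  have "0 < limsup (\<lambda>Q. ereal (f Q))" using assms(5) by (simp add: wQIA_def f_def)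
  then obtain c where c: "0 < ereal c" "ereal c < limsup (\<lambda>Q. ereal (f Q))"
    using ereal_dense2 by blast
  have freq: "\<exists>\<^sub>F Q in sequentially. c < f Q"
  proof (rule ccontr)
    assume "\<not> (\<exists>\<^sub>F Q in sequentially. c < f Q)"
    then have "\<forall>\<^sub>F Q in sequentially. ereal (f Q) \<le> ereal c"
      by (simp add: not_frequently not_less)
    then have "limsup (\<lambda>Q. ereal (f Q)) \<le> ereal c" by (rule Limsup_bounded)
    then show False using c by simp
  qed
  \<comment> \<open>Obtained from \<open>D' <= 3 * A'^2 + C * D\<close> by inserting
    \<open>D <= A^2 / c\<close> and \<open>A <= A'\<close>.\<close>
  define c' where "c' = 1 / (3 + C / c)"
  have c0: "c > 0" using c by simp
  have c': "c' > 0" using c0 C by (simp add: c'_def add_pos_pos)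
  have bound: "c' \<le> f' Q" if "c < f Q" for Q
  proof -
    let ?A = "QIA_num n m B Q" and ?A' = "QIA_num (n + k) m B' Q"
    let ?D = "QIA_den n m w B Q" and ?D' = "QIA_den (n + k) m w' B' Q"
    \<comment> \<open>With denominator 0, \<open>f Q\<close> would be 0 and not above
      \<open>c\<close>.\<close>
    have D: "0 < ?D" using that c0 QIA_den_nonneg[of n m w B Q] by (cases "?D = 0") (auto simp: f_def)
    then have A2: "?D \<le> ?A\<^sup>2 / c" using that c0 by (simp add: f_def field_simps)
    have Nk: "n + k \<ge> 1" using assms by simp
    have A0: "0 \<le> ?A" unfolding QIA_num_eq[OF assms(1)] by (intro sum_nonneg) simp
    have AA: "?A \<le> ?A'"
      unfolding QIA_num_eq[OF assms(1)] QIA_num_eq[OF Nk] B'_def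
      using assms by (intro sum_mono shrunk_mass_ge) auto
    have "?A \<noteq> 0" using that c0 by (auto simp: f_def)
    then have A'0: "0 < ?A'" using A0 AA by simp
    then have D': "0 < ?D'" by (intro QIA_den_pos Nk)
    have "?D' \<le> 3 * ?A'\<^sup>2 + C * ?D"
      unfolding B'_def w'_def C_def using assms by (intro QIA_den_shrunk_le) auto
    also have "\<dots> \<le> 3 * ?A'\<^sup>2 + C * (?A'\<^sup>2 / c)"
    proof -
      have "?A\<^sup>2 / c \<le> ?A'\<^sup>2 / c" using AA A0 c0 by (intro divide_right_mono power_mono) auto
      then show ?thesis using A2 C by (intro add_left_mono mult_left_mono) auto
    qed
    also have "\<dots> = (3 + C / c) * ?A'\<^sup>2" by (simp add: algebra_simps)
    finally have "?D' \<le> (3 + C / c) * ?A'\<^sup>2" .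
    moreover have "3 + C / c > 0" using C c0 by (simp add: add_pos_pos)
    ultimately show ?thesis using D' by (simp add: f'_def c'_def divide_simps mult.commute)
  qed
  have "0 < limsup (\<lambda>Q. ereal (f' Q))"
  proof (rule ccontr)
    assume "\<not> 0 < limsup (\<lambda>Q. ereal (f' Q))"
    then have "limsup (\<lambda>Q. ereal (f' Q)) < ereal c'"
      using c' by (metis ereal_less(2) not_less order_le_less_trans)
    then have "\<forall>\<^sub>F Q in sequentially. ereal (f' Q) < ereal c'" by (rule Limsup_lessD)
    then have "\<exists>\<^sub>F Q in sequentially. c < f Q \<and> ereal (f' Q) < ereal c'"
      using freq by (rule frequently_eventually_frequently[OF _ , rotated])
    then obtain Q where "c < f Q" "f' Q < c'" using frequently_ex by force
    then show False using bound[of Q] by simp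
  qed
  then show ?thesis by (simp add: wQIA_def f'_def B'_def w'_def)
qed

end
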